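(* Let $m,n\ge 1$ and $r\ge 0$ be integers. The elements $\mathrm{hp}_\lambda(x_1,\dots,x_m;y_1,\dots,y_n)$, $\lambda\in H^{\vee}(m|n,r)$, form a $\mathbb{C}$-basis of $\Lambda^r_{m|n}$.
   Context: $\Lambda_{m|n}$ is the subring of $\mathbb{C}[x_1,\dots,x_m,y_1,\dots,y_n]$ consisting of the polynomials $f$ that are symmetric in $x_1,\dots,x_m$, symmetric in $y_1,\dots,y_n$, and such that the specialization $f|_{x_m=t=-y_n}$ (i.e. $x_m=t$, $y_n=-t$) is independent of $t$. $\Lambda^r_{m|n}$ is the subspace of $\Lambda_{m|n}$ of homogeneous polynomials of degree $r$ together with $0$. For $k\ge 1$, $\mathrm{hp}_k(x_1,\dots,x_m;y_1,\dots,y_n)=\sum_{i=1}^m x_i^k+(-1)^{k-1}\sum_{j=1}^n y_j^k$, and for a partition $\lambda=(\lambda_1\ge\dots\ge\lambda_\ell>0)$, $\mathrm{hp}_\lambda=\prod_{i=1}^{\ell}\mathrm{hp}_{\lambda_i}$ (so $\mathrm{hp}_\emptyset=1$). For $a,b\ge 1$, $H(a|b,r)$ is the set of partitions $\lambda$ of $r$ with $\lambda_{a+1}\le b$ (where $\lambda_i=0$ for $i$ larger than the length). $H^{\vee}(m|n,r):=H(\min(m,n)\,|\,\max(m,n),r)$. *)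

theory Defs
  imports
    Complex_Main
    "HOL-Library.Poly_Mapping"
    "HOL-Combinatorics.Permutations"
begin

text \<open>Polynomials are finitely supported maps from monomials (finitely supported exponent
  functions on the variables) to coefficients, with the ring structure of \<open>Poly_Mapping\<close>.
  \<open>T\<close> is the additional indeterminate written \<open>t\<close> in the specialization
  \<open>x\<^sub>m = t = -y\<^sub>n\<close>. The variables \<open>X i\<close> and \<open>Y j\<close> are numbered from 1.\<close>

datatype var = X nat | Y nat | T

type_synonym monom = "var \<Rightarrow>\<^sub>0 nat"
type_synonym mpoly = "monom \<Rightarrow>\<^sub>0 complex"

definition mvar :: "var \<Rightarrow> mpoly" where
  "mvar v = Poly_Mapping.single (Poly_Mapping.single v 1) 1"

definition mconst :: "complex \<Rightarrow> mpoly" where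
  "mconst c = Poly_Mapping.single 0 c"

definition mpoly_scale :: "complex \<Rightarrow> mpoly \<Rightarrow> mpoly" where
  "mpoly_scale c f = mconst c * f"

global_interpretation mpoly: vector_space mpoly_scale
  by unfold_locales
    (simp_all add: mpoly_scale_def mconst_def distrib_left distrib_right single_add
      mult_single mult.assoc [symmetric])

definition mvars :: "mpoly \<Rightarrow> var set" where
  "mvars f = (\<Union>\<mu>\<in>Poly_Mapping.keys f. Poly_Mapping.keys \<mu>)"

text \<open>The image of \<open>f\<close> under the \<open>\<complex>\<close>-algebra endomorphism that sends each variable \<open>v\<close>
  to \<open>\<sigma> v\<close>.\<close>

definition msubst :: "(var \<Rightarrow> mpoly) \<Rightarrow> mpoly \<Rightarrow> mpoly" where
  "msubst \<sigma> f = (\<Sum>\<mu>\<in>Poly_Mapping.keys f. mconst (Poly_Mapping.lookup f \<mu>) *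
     (\<Prod>v\<in>Poly_Mapping.keys \<mu>. \<sigma> v ^ Poly_Mapping.lookup \<mu> v))"

definition mdeg :: "monom \<Rightarrow> nat" where
  "mdeg \<mu> = (\<Sum>v\<in>Poly_Mapping.keys \<mu>. Poly_Mapping.lookup \<mu> v)"

definition homogeneous_or_zero :: "nat \<Rightarrow> mpoly \<Rightarrow> bool" where
  "homogeneous_or_zero r f \<longleftrightarrow> (\<forall>\<mu>\<in>Poly_Mapping.keys f. mdeg \<mu> = r)"

fun perm_X :: "(nat \<Rightarrow> nat) \<Rightarrow> var \<Rightarrow> var" where
  "perm_X \<pi> (X i) = X (\<pi> i)"
| "perm_X \<pi> (Y j) = Y j"
| "perm_X \<pi> T = T"

fun perm_Y :: "(nat \<Rightarrow> nat) \<Rightarrow> var \<Rightarrow> var" where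
  "perm_Y \<pi> (X i) = X i"
| "perm_Y \<pi> (Y j) = Y (\<pi> j)"
| "perm_Y \<pi> T = T"

definition symmetric_X :: "nat \<Rightarrow> mpoly \<Rightarrow> bool" where
  "symmetric_X m f \<longleftrightarrow>
     (\<forall>\<pi>. \<pi> permutes {1..m} \<longrightarrow> msubst (\<lambda>v. mvar (perm_X \<pi> v)) f = f)"

definition symmetric_Y :: "nat \<Rightarrow> mpoly \<Rightarrow> bool" where
  "symmetric_Y n f \<longleftrightarrow>
     (\<forall>\<pi>. \<pi> permutes {1..n} \<longrightarrow> msubst (\<lambda>v. mvar (perm_Y \<pi> v)) f = f)"

definition specialize :: "nat \<Rightarrow> nat \<Rightarrow> mpoly \<Rightarrow> mpoly" where
  "specialize m n = msubst (mvar(X m := mvar T, Y n := - mvar T))"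

definition Lambda :: "nat \<Rightarrow> nat \<Rightarrow> mpoly set" where
  "Lambda m n = {f. mvars f \<subseteq> X ` {1..m} \<union> Y ` {1..n} \<and>
     symmetric_X m f \<and> symmetric_Y n f \<and> T \<notin> mvars (specialize m n f)}"

definition Lambda_deg :: "nat \<Rightarrow> nat \<Rightarrow> nat \<Rightarrow> mpoly set" where
  "Lambda_deg m n r = {f \<in> Lambda m n. homogeneous_or_zero r f}"

text \<open>The exponent \<open>k - 1\<close> is a truncated subtraction; \<open>hp\<close> is meant for \<open>k \<ge> 1\<close> only.\<close>

definition hp :: "nat \<Rightarrow> nat \<Rightarrow> nat \<Rightarrow> mpoly" where
  "hp m n k = (\<Sum>i=1..m. mvar (X i) ^ k) + (- 1) ^ (k - 1) * (\<Sum>j=1..n. mvar (Y j) ^ k)"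

definition hp_part :: "nat \<Rightarrow> nat \<Rightarrow> nat list \<Rightarrow> mpoly" where
  "hp_part m n la = (\<Prod>k\<leftarrow>la. hp m n k)"

definition partitions :: "nat \<Rightarrow> nat list set" where
  "partitions r = {la. sorted_wrt (\<ge>) la \<and> (\<forall>k\<in>set la. k > 0) \<and> sum_list la = r}"

text \<open>The \<open>i\<close>-th part, counted from 1; it is 0 beyond the length of the partition.\<close>

definition part :: "nat list \<Rightarrow> nat \<Rightarrow> nat" where
  "part la i = (if 1 \<le> i \<and> i \<le> length la then la ! (i - 1) else 0)"

definition hook :: "nat \<Rightarrow> nat \<Rightarrow> nat \<Rightarrow> nat list set" where
  "hook a b r = {la \<in> partitions r. part la (a + 1) \<le> b}"

definition hook_dual :: "nat \<Rightarrow> nat \<Rightarrow> nat \<Rightarrow> nat list set" where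
  "hook_dual m n r = hook (min m n) (max m n) r"

end

theory Submission
  imports
    Defs
    "HOL-Computational_Algebra.Polynomial_FPS"
    "HOL-Computational_Algebra.Fundamental_Theorem_Algebra"
    "HOL-Library.Function_Algebras"
    "Jordan_Normal_Form.Determinant"
begin

text \<open>
The \<open>hp\<^sub>\<lambda>\<close> with \<open>\<lambda>\<close> in the dual hook are shown to be linearly independent, and the space of
supersymmetric polynomials of degree \<open>r\<close> is shown to have dimension at most the number of these
\<open>\<lambda>\<close>. Together the two facts say that the \<open>hp\<^sub>\<lambda>\<close> form a basis.

\<^emph>\<open>Independence.\<close> With \<open>z = - y\<close> the value of \<open>hp\<^sub>k\<close> is \<open>p\<^sub>k = \<Sum> x\<^sub>i^k - \<Sum> z\<^sub>j^k\<close>, and exchanging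
\<open>x\<close> and \<open>z\<close> only changes its sign, so let \<open>m \<le> n\<close>. The coefficient of \<open>u^k\<close> in the logarithm of
\<open>E(u) / X(u)\<close> is \<open>p\<^sub>k / k\<close>, where \<open>X = \<Prod> (1 - x\<^sub>i u)\<close> and \<open>E = \<Prod> (1 - z\<^sub>j u)\<close>. Since \<open>m \<le> n\<close> and
every complex polynomial splits, \<open>E = X + t G\<close> is a possible choice for every
\<open>G = g\<^sub>1 u + \<dots> + g\<^sub>n u^n\<close>, and then \<open>p\<^sub>k = t k [u^k] (G / X) + o(t)\<close> as \<open>t\<close> tends to 0
(\<open>super_psum_first_order\<close>). Here \<open>[u^k] (G / X) = \<Sum>\<^sub>j g\<^sub>j h\<^sub>k\<^sub>-\<^sub>j(x)\<close> with the complete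
homogeneous symmetric polynomials \<open>h\<close>. If the \<open>g\<^sub>j\<close> grow rapidly with \<open>j\<close>, the dominant term is,
up to a factor \<open>k\<close>, \<open>g\<^sub>k\<close> for \<open>k \<le> n\<close> and \<open>g\<^sub>n h\<^sub>k\<^sub>-\<^sub>n(x)\<close> for \<open>k \<ge> n\<close>. In a relation among the
\<open>hp\<^sub>\<lambda>\<close> the terms of lowest order in \<open>t\<close> and of dominant size in \<open>g\<close> all have the same parts below
\<open>n\<close> and equally many parts from \<open>n\<close> on, so they differ only in the excesses \<open>\<lambda>\<^sub>i - n\<close>. At most \<open>m\<close>
of these are nonzero by the hook condition, which leaves a relation among products of at most \<open>m\<close>
of the \<open>h\<^sub>k\<close> in \<open>m\<close> variables. There is none (\<open>hsym_products_independent\<close>): the Jacobi--Trudi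
determinants are combinations of these products, there are as many of them, and they are
independent because, up to a factor that does not depend on the partition, they are the alternants
\<open>det (x\<^sub>l^(\<mu>\<^sub>i + m - i))\<close>.

\<^emph>\<open>Dimension.\<close> Setting \<open>x\<^sub>m = y\<^sub>n = 0\<close> maps supersymmetric polynomials for \<open>m|n\<close> to those for
\<open>m-1|n-1\<close>. A polynomial in the kernel vanishes whenever \<open>x\<^sub>i = - y\<^sub>j\<close> and so, as a polynomial in
one \<open>x\<^sub>i\<close>, has \<open>n\<close> distinct roots; if it is nonzero, it must contain a monomial in which all
\<open>x\<close>-exponents are at least \<open>n\<close> (\<open>coefficients_vanish_step\<close>). Iterating, a supersymmetric
polynomial is determined by its coefficients at the monomials in \<open>x\<^sub>1, \<dots>, x\<^sub>a, y\<^sub>1, \<dots>, y\<^sub>b\<close> with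
\<open>a - b = m - n\<close>, weakly decreasing exponents and all \<open>x\<close>-exponents at least \<open>b\<close>. Cutting the
diagram of a partition along an \<open>a \<times> b\<close> rectangle and transposing the lower piece shows that there
are at most as many such monomials of degree \<open>r\<close> as there are partitions in the dual hook
(\<open>xy_monom_in_hook_monoms\<close>).
\<close>

section \<open>Linear algebra and vanishing polynomials\<close>

lemma (in vector_space) independent_familyI:
  assumes fin: "finite A"
    and zero: "\<And>c. (\<Sum>a\<in>A. c a *s v a) = 0 \<Longrightarrow> (\<And>a. a \<in> A \<Longrightarrow> c a = 0)"
  shows "inj_on v A \<and> independent (v ` A)"
proof
  show inj: "inj_on v A"
  proof (rule inj_onI, rule ccontr)
    fix a b assume ab: "a \<in> A" "b \<in> A" "v a = v b" "a \<noteq> b"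
    define c where "c = (\<lambda>x. if x = a then 1 else if x = b then - 1 else (0::'a))"
    have "(\<Sum>x\<in>A. c x *s v x) = (\<Sum>x\<in>{a,b}. c x *s v x)"
      by (rule sum.mono_neutral_right) (use ab fin in \<open>auto simp: c_def\<close>)
    also have "\<dots> = 0" using ab by (simp add: c_def)
    finally have "c a = 0" using zero ab by blast
    then show False by (simp add: c_def)
  qed
  show "independent (v ` A)"
  proof
    assume "dependent (v ` A)"
    then obtain u where u: "(\<exists>w\<in>v ` A. u w \<noteq> 0)" "(\<Sum>w\<in>v ` A. u w *s w) = 0"
      using dependent_finite[of "v ` A"] fin by auto
    have "(\<Sum>a\<in>A. u (v a) *s v a) = 0"
      using u(2) by (simp add: sum.reindex[OF inj])
    then have "\<And>a. a \<in> A \<Longrightarrow> u (v a) = 0" using zero[of "\<lambda>a. u (v a)"] by blast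
    then show False using u(1) by auto
  qed
qed

lemma (in vector_space) independent_familyD:
  assumes fin: "finite A" and inj: "inj_on v A" and ind: "independent (v ` A)"
    and "(\<Sum>a\<in>A. c a *s v a) = 0" and "a \<in> A"
  shows "c a = 0"
proof -
  have "(\<Sum>w\<in>v ` A. c (the_inv_into A v w) *s w) = (\<Sum>a\<in>A. c a *s v a)"
    by (simp add: sum.reindex[OF inj] the_inv_into_f_f[OF inj])
  then have "c (the_inv_into A v (v a)) = 0"
    using independentD[OF ind, of "v ` A" "\<lambda>w. c (the_inv_into A v w)" "v a"] assms by auto
  then show ?thesis using assms by (simp add: the_inv_into_f_f[OF inj])
qed

text \<open>
Counting: \<open>card A\<close> independent vectors do not fit into the span of fewer than \<open>card A\<close> vectors, so
none of the \<open>v a\<close> can be repeated or redundant.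
\<close>

lemma (in vector_space) independent_family_of_spanning:
  assumes fin: "finite A" and inj: "inj_on w A" and ind: "independent (w ` A)"
    and sub: "w ` A \<subseteq> span (v ` A)"
  shows "inj_on v A \<and> independent (v ` A)"
proof
  have cw: "card (w ` A) = card A" by (rule card_image[OF inj])
  have le: "card A \<le> card T" if "finite T" "w ` A \<subseteq> span T" for T
    using independent_span_bound[OF that(1) ind that(2)] cw by simp
  have "card (v ` A) = card A"
    using le[of "v ` A"] sub fin card_image_le[OF fin, of v] by auto
  then show "inj_on v A" by (rule eq_card_imp_inj_on[OF fin])
  show "independent (v ` A)"
  proof
    assume "dependent (v ` A)"
    then obtain a where a: "a \<in> v ` A" "a \<in> span (v ` A - {a})" by (auto simp: dependent_def)
    have "span (v ` A - {a}) = span (v ` A)"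
      using span_redundant[OF a(2)] a(1) by (simp add: insert_absorb)
    then have "card A \<le> card (v ` A - {a})" using le[of "v ` A - {a}"] sub fin by auto
    also have "\<dots> < card (v ` A)" using a(1) fin by (meson card_Diff1_less finite_imageI)
    also have "\<dots> = card A" by fact
    finally show False by simp
  qed
qed

lemma univariate_coeff_eq_0:
  fixes a :: "'i \<Rightarrow> complex"
  assumes "finite I" and "finite F" and "\<And>t. t \<notin> F \<Longrightarrow> (\<Sum>i\<in>I. a i * t ^ e i) = 0"
  shows "(\<Sum>i | i \<in> I \<and> e i = k. a i) = 0"
proof -
  define p where "p = (\<Sum>i\<in>I. Polynomial.monom (a i) (e i))"
  have "- F \<subseteq> {t. poly p t = 0}" using assms(3) by (auto simp: p_def poly_sum poly_monom)
  moreover have "infinite (- F)" using assms(2) infinite_UNIV_char_0[where 'a = complex]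
    by (simp add: finite_compl)
  ultimately have "infinite {t. poly p t = 0}" by (rule infinite_super)
  then have "p = 0" using poly_roots_finite by blast
  then have "0 = coeff p k" by simp
  also have "\<dots> = (\<Sum>i\<in>I. if e i = k then a i else 0)" by (simp add: p_def coeff_sum)
  also have "\<dots> = (\<Sum>i | i \<in> I \<and> e i = k. a i)"
    using assms(1) by (simp add: sum.inter_filter)
  finally show ?thesis by simp
qed

text \<open>
A polynomial function that vanishes at all points with pairwise distinct coordinates is the zero
polynomial; fixing the variables one at a time leaves infinitely many values for the next one. The
terms are indexed by \<open>I\<close>, and terms with the same exponents are collected. Only points with
distinct coordinates are available in \<open>coefficients_vanish_step\<close>, where the coordinates give the
roots of another polynomial.
\<close>

lemma multivariate_coeff_eq_0:
  fixes c :: "'i \<Rightarrow> complex" and e :: "'i \<Rightarrow> 'v \<Rightarrow> nat"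
  assumes "finite V" "finite I"
    and "\<And>x :: 'v \<Rightarrow> complex. inj_on x V \<Longrightarrow> (\<Sum>i\<in>I. c i * (\<Prod>v\<in>V. x v ^ e i v)) = 0"
  shows "(\<Sum>i | i \<in> I \<and> (\<forall>v\<in>V. e i v = k v). c i) = 0"
  using assms
proof (induction V arbitrary: I rule: finite_induct)
  case empty
  then show ?case by simp
next
  case (insert v V)
  define J where "J = {i \<in> I. e i v = k v}"
  have "(\<Sum>i\<in>J. c i * (\<Prod>w\<in>V. x w ^ e i w)) = 0" if x: "inj_on x V" for x :: "'v \<Rightarrow> complex"
  proof -
    have "(\<Sum>i\<in>I. (c i * (\<Prod>w\<in>V. x w ^ e i w)) * t ^ e i v) = 0" if t: "t \<notin> x ` V" for t
    proof -
      have "(\<Prod>w\<in>insert v V. (x(v := t)) w ^ e i w) = (\<Prod>w\<in>V. x w ^ e i w) * t ^ e i v" for i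
      proof -
        have "(\<Prod>w\<in>V. (x(v := t)) w ^ e i w) = (\<Prod>w\<in>V. x w ^ e i w)"
          using insert.hyps by (intro prod.cong) auto
        then show ?thesis using insert.hyps by simp
      qed
      moreover have "inj_on (x(v := t)) (insert v V)"
        using x t insert.hyps by (auto simp: inj_on_def)
      moreover from this have "(\<Sum>i\<in>I. c i * (\<Prod>w\<in>insert v V. (x(v := t)) w ^ e i w)) = 0"
        by (rule insert.prems(2))
      ultimately show ?thesis by (simp only: mult.assoc)
    qed
    from univariate_coeff_eq_0[where k = "k v", OF insert.prems(1) finite_imageI[OF insert.hyps(1)] this]
    show ?thesis using insert.hyps by (simp add: J_def)
  qed
  then have "(\<Sum>i | i \<in> J \<and> (\<forall>w\<in>V. e i w = k w). c i) = 0"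
    using insert.IH[of J] insert.prems(1) by (simp add: J_def)
  moreover have "{i \<in> J. \<forall>w\<in>V. e i w = k w} = {i \<in> I. \<forall>w\<in>insert v V. e i w = k w}"
    by (auto simp: J_def)
  ultimately show ?case by simp
qed

section \<open>Products of complete homogeneous symmetric polynomials\<close>

text \<open>
The denominator of the generating function of the complete homogeneous symmetric polynomials in
the variables \<open>x i\<close> with \<open>i \<in> S\<close>.
\<close>

definition den :: "nat set \<Rightarrow> (nat \<Rightarrow> complex) \<Rightarrow> complex fps" where
  "den S x = (\<Prod>i\<in>S. 1 - fps_const (x i) * fps_X)"

definition hsym :: "nat \<Rightarrow> (nat \<Rightarrow> complex) \<Rightarrow> nat \<Rightarrow> complex" where
  "hsym m x k = fps_nth (inverse (den {1..m} x)) k"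

lemma den_nth_0 [simp]: "fps_nth (den S x) 0 = 1"
  by (induction S rule: infinite_finite_induct) (simp_all add: den_def)

lemma den_inverse: "den S x * inverse (den S x) = 1"
  by (rule inverse_mult_eq_1') simp

lemma den_nth_eq_0:
  assumes "finite S" "card S < j"
  shows "fps_nth (den S x) j = 0"
  using assms
proof (induction S arbitrary: j rule: finite_induct)
  case empty
  then show ?case by (simp add: den_def)
next
  case (insert i S)
  have "den (insert i S) x = den S x - fps_const (x i) * (fps_X * den S x)"
    using insert.hyps by (simp add: den_def algebra_simps)
  then show ?case using insert by (cases j) auto
qed

text \<open>
Compare coefficients in \<open>1 / (1 - x\<^sub>l u) = X\<^sub>l(u) / X(u)\<close>, where \<open>X\<^sub>l\<close> is the product \<open>X\<close> without
its factor \<open>1 - x\<^sub>l u\<close>, a polynomial of degree less than \<open>m\<close>. Multiplication by \<open>fps_X ^ j\<close> shifts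
the index of \<open>h\<close> and makes \<open>h\<close> with negative index 0.
\<close>

lemma power_eq_sum_hsym:
  assumes "l \<in> {1..m}"
  shows "x l ^ a = (\<Sum>j<m. fps_nth (fps_X ^ j * inverse (den {1..m} x)) a *
    fps_nth (den ({1..m} - {l}) x) j)"
proof -
  define g where "g = Abs_fps (\<lambda>k. x l ^ k)"
  define q where "q = den ({1..m} - {l}) x"
  have g: "g * (1 - fps_const (x l) * fps_X) = 1"
  proof (rule fps_ext)
    fix k
    have "g * (1 - fps_const (x l) * fps_X) = g - fps_const (x l) * (fps_X * g)"
      by (simp add: algebra_simps)
    then show "fps_nth (g * (1 - fps_const (x l) * fps_X)) k = fps_nth 1 k"
      by (cases k) (auto simp: g_def)
  qed
  have "den {1..m} x = (1 - fps_const (x l) * fps_X) * q"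
    using assms by (simp add: den_def q_def prod.remove)
  then have "g * den {1..m} x = q" using g by (simp add: mult.assoc [symmetric])
  then have "q * inverse (den {1..m} x) = g"
    by (metis den_inverse mult.assoc mult.right_neutral)
  then have "x l ^ a = fps_nth (q * inverse (den {1..m} x)) a" by (simp add: g_def)
  also have "\<dots> = (\<Sum>j\<le>a. fps_nth q j * fps_nth (inverse (den {1..m} x)) (a - j))"
    by (simp add: fps_mult_nth atLeast0AtMost)
  also have "\<dots> = (\<Sum>j\<in>{..a} \<inter> {..<m}. fps_nth q j * fps_nth (inverse (den {1..m} x)) (a - j))"
    using assms by (intro sum.mono_neutral_right) (auto simp: q_def intro: den_nth_eq_0)
  also have "\<dots> = (\<Sum>j<m. fps_nth (fps_X ^ j * inverse (den {1..m} x)) a * fps_nth q j)"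
    by (rule sum.mono_neutral_cong_left) (auto simp: fps_X_power_mult_nth)
  finally show ?thesis by (simp add: q_def)
qed

text \<open>
Partitions of \<open>d\<close> into at most \<open>m\<close> parts, filled up with zeros to length \<open>m\<close>, so that a product
over the list has exactly \<open>m\<close> factors.
\<close>

definition padded_partitions :: "nat \<Rightarrow> nat \<Rightarrow> nat list set" where
  "padded_partitions m d = {mu. length mu = m \<and> sorted_wrt (\<ge>) mu \<and> sum_list mu = d}"

lemma finite_padded_partitions: "finite (padded_partitions m d)"
proof (rule finite_subset)
  show "padded_partitions m d \<subseteq> {xs. set xs \<subseteq> {..d} \<and> length xs = m}"
    by (auto simp: padded_partitions_def member_le_sum_list)
qed (rule finite_lists_length_eq, simp)

text \<open>
The exponents \<open>\<mu>\<^sub>i + m - i\<close> of the alternant of \<open>\<mu>\<close>, strictly decreasing in \<open>i\<close>. Here \<open>i\<close> is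
counted from 0, hence the 1 in the definition.
\<close>

definition shifted :: "nat list \<Rightarrow> nat \<Rightarrow> nat" where
  "shifted mu i = mu ! i + (length mu - 1 - i)"

lemma shifted_strict:
  assumes "sorted_wrt (\<ge>) mu" "i < j" "j < length mu"
  shows "shifted mu j < shifted mu i"
  using assms sorted_wrt_nth_less[OF assms(1) assms(2,3)] by (simp add: shifted_def)

text \<open>
Two strictly decreasing sequences that are rearrangements of each other are equal, and the
rearrangement is trivial. Hence no monomial occurs in two alternants or twice in one.
\<close>

lemma shifted_permuted_eq:
  assumes mu: "mu \<in> padded_partitions m d" and nu: "nu \<in> padded_partitions m d"
    and p: "p permutes {0..<m}"
    and eq: "\<forall>l\<in>{0..<m}. shifted mu (Hilbert_Choice.inv p l) = shifted nu l"
  shows "mu = nu \<and> p = id"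
proof -
  let ?q = "Hilbert_Choice.inv p"
  have q: "?q permutes {0..<m}" by (rule permutes_inv[OF p])
  have len: "length mu = m" "length nu = m" and srt: "sorted_wrt (\<ge>) mu" "sorted_wrt (\<ge>) nu"
    using mu nu by (auto simp: padded_partitions_def)
  have mono: "?q i < ?q j" if "i < j" "j < m" for i j
  proof (rule ccontr)
    assume "\<not> ?q i < ?q j"
    moreover have "?q i \<noteq> ?q j" using permutes_inj[OF q] that by (auto dest: injD)
    ultimately have "?q j < ?q i" by simp
    moreover have "?q i < m" using permutes_in_image[OF q, of i] that by auto
    ultimately have "shifted mu (?q i) < shifted mu (?q j)" 
      using shifted_strict[OF srt(1)] len by simp
    then show False using shifted_strict[OF srt(2) that(1)] eq that len by fastforce
  qed
  \<comment> \<open>a strictly increasing self-map of an initial segment of the naturals is the identity\<close>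
  have ge: "i \<le> ?q i" if "i < m" for i
    using that
  proof (induction i)
    case (Suc i)
    then show ?case using mono[of i "Suc i"] by simp
  qed simp
  have qid: "?q i = i" if "i < m" for i
    using that
  proof (induction "m - i" arbitrary: i rule: less_induct)
    case less
    have "?q i < m" using permutes_in_image[OF q, of i] less.prems by auto
    show ?case
    proof (rule ccontr)
      assume "?q i \<noteq> i"
      then have "i < ?q i" using ge[OF less.prems] by simp
      then have "?q (?q i) = ?q i" using less.hyps[of "?q i"] \<open>?q i < m\<close> by simp
      then show False using \<open>?q i \<noteq> i\<close> permutes_inj[OF q] by (auto dest: injD)
    qed
  qed
  have "?q = id"
    using qid permutes_not_in[OF q] by (intro ext) (metis atLeast0LessThan id_apply lessThan_iff)
  then have "p = id" by (metis inv_id inv_inv_eq p permutes_bij)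
  moreover have "mu = nu"
  proof (rule nth_equalityI)
    fix i assume "i < length mu"
    then have "shifted mu i = shifted nu i" using eq qid len by auto
    then show "mu ! i = nu ! i" using len \<open>i < length mu\<close> by (simp only: shifted_def)
  qed (simp add: len)
  ultimately show ?thesis by blast
qed

definition alternant :: "nat list \<Rightarrow> (nat \<Rightarrow> complex) \<Rightarrow> complex mat" where
  "alternant mu x = mat (length mu) (length mu) (\<lambda>(i, l). x (Suc l) ^ shifted mu i)"

definition jacobi_trudi :: "nat list \<Rightarrow> (nat \<Rightarrow> complex) \<Rightarrow> complex mat" where
  "jacobi_trudi mu x = mat (length mu) (length mu)
     (\<lambda>(i, j). fps_nth (fps_X ^ j * inverse (den {1..length mu} x)) (shifted mu i))"

lemma alternants_independent:
  assumes "\<And>x. (\<Sum>mu\<in>padded_partitions m d. c mu * det (alternant mu x)) = 0"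
    and nu: "nu \<in> padded_partitions m d"
  shows "c nu = (0::complex)"
proof -
  let ?A = "padded_partitions m d" and ?P = "{p. p permutes {0..<m}}"
  let ?e = "\<lambda>(mu, p) l. shifted mu (Hilbert_Choice.inv p l)"
  let ?c = "\<lambda>(mu, p). c mu * signof p"
  have "(\<Sum>i\<in>?A \<times> ?P. ?c i * (\<Prod>v\<in>{0..<m}. y v ^ ?e i v)) = 0" for y
  proof -
    \<comment> \<open>the variables of the alternant are numbered from 1, the columns of the matrix from 0\<close>
    define x where "x = (\<lambda>l. y (l - 1))"
    have "c mu * det (alternant mu x) =
        (\<Sum>p\<in>?P. ?c (mu, p) * (\<Prod>v\<in>{0..<m}. y v ^ ?e (mu, p) v))" if "mu \<in> ?A" for mu
    proof -
      have len: "length mu = m" using that by (simp add: padded_partitions_def)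
      have "(\<Prod>i = 0..<m. alternant mu x $$ (i, p i)) = (\<Prod>v\<in>{0..<m}. y v ^ ?e (mu, p) v)"
        if "p \<in> ?P" for p
      proof -
        have p: "p permutes {0..<m}" using that by simp
        have "(\<Prod>v\<in>{0..<m}. y v ^ ?e (mu, p) v) = (\<Prod>i = 0..<m. y (p i) ^ shifted mu i)"
          by (subst prod.permute[OF p]) (simp add: o_def permutes_inverses(2)[OF p])
        also have "\<dots> = (\<Prod>i = 0..<m. alternant mu x $$ (i, p i))"
          using permutes_in_image[OF p] len
          by (intro prod.cong) (auto simp: alternant_def x_def)
        finally show ?thesis by simp
      qed
      then show ?thesis
        using len by (subst det_def'[where n = m])
          (auto simp: alternant_def sum_distrib_left mult.assoc intro!: sum.cong)
    qed
    then show ?thesis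
      using assms(1)[of x] sum.cartesian_product'[of "\<lambda>i. ?c i * (\<Prod>v\<in>{0..<m}. y v ^ ?e i v)" ?A ?P]
      by simp
  qed
  then have "(\<Sum>i | i \<in> ?A \<times> ?P \<and> (\<forall>v\<in>{0..<m}. ?e i v = shifted nu v). ?c i) = 0"
    using finite_padded_partitions finite_permutations[of "{0..<m}"]
    by (intro multivariate_coeff_eq_0) auto
  also have "{i. i \<in> ?A \<times> ?P \<and> (\<forall>v\<in>{0..<m}. ?e i v = shifted nu v)} = {(nu, id)}"
    using shifted_permuted_eq[OF _ nu] nu by (auto simp: permutes_id)
  finally show ?thesis by simp
qed

text \<open>
By \<open>power_eq_sum_hsym\<close> the alternant matrix is the Jacobi--Trudi matrix times a matrix that
depends on \<open>x\<close> and the number of rows only.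
\<close>

lemma det_alternant:
  "det (alternant mu x) = det (jacobi_trudi mu x) *
     det (mat (length mu) (length mu)
       (\<lambda>(j, l). fps_nth (den ({1..length mu} - {Suc l}) x) j))"
  (is "_ = _ * det ?C")
proof -
  let ?m = "length mu"
  have "alternant mu x = jacobi_trudi mu x * ?C"
    by (rule eq_matI)
      (auto simp: alternant_def jacobi_trudi_def scalar_prod_def power_eq_sum_hsym[of _ ?m] atLeast0LessThan)
  then show ?thesis
    by (simp add: det_mult[of _ ?m] jacobi_trudi_def)
qed

lemma jacobi_trudi_independent:
  assumes "\<And>x. (\<Sum>mu\<in>padded_partitions m d. c mu * det (jacobi_trudi mu x)) = 0"
    and nu: "nu \<in> padded_partitions m d"
  shows "c nu = (0::complex)"
proof (rule alternants_independent[OF _ nu])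
  fix x
  let ?D = "det (mat m m (\<lambda>(j, l). fps_nth (den ({1..m} - {Suc l}) x) j))"
  have "(\<Sum>mu\<in>padded_partitions m d. c mu * det (alternant mu x)) =
      (\<Sum>mu\<in>padded_partitions m d. c mu * det (jacobi_trudi mu x)) * ?D"
    unfolding sum_distrib_right
    by (intro sum.cong) (auto simp: det_alternant padded_partitions_def)
  then show "(\<Sum>mu\<in>padded_partitions m d. c mu * det (alternant mu x)) = 0"
    using assms(1) by simp
qed

lemma sum_shifted:
  assumes "mu \<in> padded_partitions m d"
  shows "(\<Sum>i<m. shifted mu i) = d + (\<Sum>i<m. i)"
proof -
  have len: "length mu = m" and d: "sum_list mu = d"
    using assms by (auto simp: padded_partitions_def)
  have "(\<Sum>i<m. shifted mu i) = (\<Sum>i<m. mu ! i) + (\<Sum>i<m. m - 1 - i)"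
    by (simp only: shifted_def sum.distrib len)
  also have "(\<Sum>i<m. m - 1 - i) = (\<Sum>i<m. i)" using sum.nat_diff_reindex[of "\<lambda>i. i" m] by simp
  also have "(\<Sum>i<m. mu ! i) = d" using d len by (simp add: sum_list_sum_nth atLeast0LessThan)
  finally show ?thesis .
qed

lemma sum_fun_eq: "(\<Sum>i\<in>I. f i) = (\<lambda>x. \<Sum>i\<in>I. f i x)"
  by (induction I rule: infinite_finite_induct) (auto simp: fun_eq_iff)

text \<open>
Expanding the determinant writes each Jacobi--Trudi determinant as a combination of the products
\<open>h\<^sub>\<mu>\<close> with \<open>m\<close> factors and total degree \<open>d\<close>. Determinants and products are indexed by the same
finite set, so the independence of the former gives that of the latter. The vector space is that
of all complex functions of \<open>x\<close>.
\<close>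

lemma hsym_products_independent:
  assumes "\<And>x. (\<Sum>mu\<in>padded_partitions m d. c mu * (\<Prod>k\<leftarrow>mu. hsym m x k)) = 0"
    and "nu \<in> padded_partitions m d"
  shows "c nu = 0"
proof -
  let ?A = "padded_partitions m d"
  let ?scale = "\<lambda>(c::complex) (f :: (nat \<Rightarrow> complex) \<Rightarrow> complex) x. c * f x"
  interpret fn: vector_space ?scale
    by unfold_locales (auto simp: fun_eq_iff algebra_simps)
  define F where "F = (\<lambda>mu x. \<Prod>k\<leftarrow>mu. hsym m x k)"
  define S where "S = (\<lambda>mu x. det (jacobi_trudi mu x))"
  have S: "inj_on S ?A \<and> fn.independent (S ` ?A)"
  proof (rule fn.independent_familyI[OF finite_padded_partitions])
    fix c nu
    assume c: "(\<Sum>mu\<in>?A. ?scale (c mu) (S mu)) = 0" and "nu \<in> ?A"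
    show "c nu = 0"
    proof (rule jacobi_trudi_independent[OF _ \<open>nu \<in> ?A\<close>])
      fix x
      show "(\<Sum>mu\<in>?A. c mu * det (jacobi_trudi mu x)) = 0"
        using fun_cong[OF c, of x] by (simp add: sum_fun_eq S_def)
    qed
  qed
  have "S mu \<in> fn.span (F ` ?A)" if mu: "mu \<in> ?A" for mu
  proof -
    have len: "length mu = m" using mu by (simp add: padded_partitions_def)
    define T where "T = (\<lambda>p x. \<Prod>i = 0..<m. jacobi_trudi mu x $$ (i, p i))"
    have "S mu = (\<Sum>p | p permutes {0..<m}. ?scale (signof p) (T p))"
      unfolding sum_fun_eq S_def T_def
      by (intro ext det_def') (simp add: jacobi_trudi_def len)
    moreover have "T p \<in> fn.span (F ` ?A)" if p: "p permutes {0..<m}" for p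
    proof -
      have T: "T p x = (\<Prod>i = 0..<m. if shifted mu i < p i then 0 else hsym m x (shifted mu i - p i))"
        for x unfolding T_def
        using len permutes_in_image[OF p]
        by (intro prod.cong) (auto simp: jacobi_trudi_def fps_X_power_mult_nth hsym_def)
      show ?thesis
      proof (cases "\<exists>i<m. shifted mu i < p i")
        case True
        then have "T p = 0" by (auto simp: T fun_eq_iff)
        then show ?thesis using fn.span_zero by simp
      next
        case False
        define xs where "xs = map (\<lambda>i. shifted mu i - p i) [0..<m]"
        define ys where "ys = rev (sort xs)"
        have ms: "mset ys = mset xs" by (simp add: ys_def)
        have "T p x = (\<Prod>k\<leftarrow>xs. hsym m x k)" for x
          using False by (auto simp: T xs_def o_def prod.distinct_set_conv_list[symmetric] intro!: prod.cong)
        also have "(\<Prod>k\<leftarrow>xs. hsym m x k) = (\<Prod>k\<leftarrow>ys. hsym m x k)" for x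
          using ms by (metis mset_map prod_mset_prod_list)
        finally have "T p = F ys" by (simp add: F_def fun_eq_iff)
        moreover have "ys \<in> ?A"
        proof -
          have "sum_list ys = (\<Sum>i<m. shifted mu i - p i)"
            using ms by (metis xs_def atLeast0LessThan sum_mset_sum_list interv_sum_list_conv_sum_set_nat set_upt)
          also have "\<dots> = (\<Sum>i<m. shifted mu i) - (\<Sum>i<m. p i)"
            using False by (intro sum_subtractf_nat) (metis lessThan_iff not_less)
          also have "(\<Sum>i<m. p i) = (\<Sum>i<m. i)"
            using sum.permute[OF p, of "\<lambda>i. i"] by (simp add: atLeast0LessThan o_def)
          finally have "sum_list ys = d" using sum_shifted[OF mu] by simp
          moreover have "sorted_wrt (\<ge>) ys" by (simp add: ys_def sorted_wrt_rev)
          ultimately show ?thesis by (simp add: padded_partitions_def ys_def xs_def)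
        qed
        ultimately show ?thesis by (auto intro: fn.span_base)
      qed
    qed
    ultimately show ?thesis by (auto intro!: fn.span_sum fn.span_scale)
  qed
  then have "S ` ?A \<subseteq> fn.span (F ` ?A)" by blast
  with S have F: "inj_on F ?A" "fn.independent (F ` ?A)"
    using fn.independent_family_of_spanning[OF finite_padded_partitions] by blast+
  have "(\<Sum>mu\<in>?A. ?scale (c mu) (F mu)) = 0"
    using assms(1) by (simp add: sum_fun_eq F_def fun_eq_iff)
  from fn.independent_familyD[OF finite_padded_partitions F this assms(2)] show ?thesis .
qed

section \<open>Power sums and generating functions\<close>

text \<open>
The logarithmic derivative of \<open>\<Prod> (1 - x\<^sub>i u)\<close> generates the power sums, up to sign.
\<close>

lemma fps_deriv_den:
  assumes "finite S"
  shows "fps_deriv (den S x) = - den S x * Abs_fps (\<lambda>k. \<Sum>i\<in>S. x i ^ Suc k)"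
  using assms
proof (induction S rule: finite_induct)
  case empty
  then show ?case by (simp add: den_def fps_eq_iff)
next
  case (insert i S)
  let ?l = "1 - fps_const (x i) * fps_X" and ?g = "Abs_fps (\<lambda>k. x i ^ Suc k)"
  let ?s = "Abs_fps (\<lambda>k. \<Sum>i\<in>S. x i ^ Suc k)"
  have den: "den (insert i S) x = ?l * den S x" using insert.hyps by (simp add: den_def)
  have split: "Abs_fps (\<lambda>k. \<Sum>i\<in>insert i S. x i ^ Suc k) = ?g + ?s"
    using insert.hyps by (simp add: fps_eq_iff)
  have geo: "?l * ?g = fps_const (x i)"
  proof (rule fps_ext)
    fix k
    have "?l * ?g = ?g - fps_const (x i) * (fps_X * ?g)" by (simp add: algebra_simps)
    then show "fps_nth (?l * ?g) k = fps_nth (fps_const (x i)) k" by (cases k) auto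
  qed
  have "fps_deriv (?l * den S x) = - fps_const (x i) * den S x - ?l * den S x * ?s"
    using insert.IH by (simp add: fps_const_neg [symmetric] algebra_simps del: fps_const_neg)
  also have "\<dots> = - (?l * ?g) * den S x - ?l * den S x * ?s" by (simp only: geo)
  also have "\<dots> = - (?l * den S x) * (?g + ?s)" by (simp add: algebra_simps)
  finally show ?case unfolding den split .
qed

lemma fps_of_poly_prod_linear:
  "fps_of_poly (\<Prod>i\<in>S. [:1, - x i:]) = den S x"
  unfolding den_def fps_of_poly_prod
  by (intro prod.cong) (auto simp: fps_of_poly_pCons mult.commute)

lemma degree_prod_linear: "degree (\<Prod>i\<in>S. [:1, - (x i::complex):]) \<le> card S"
proof (induction S rule: infinite_finite_induct)
  case (insert i S)
  then have "degree ([:1, - x i:] * (\<Prod>i\<in>S. [:1, - x i:])) \<le> 1 + card S"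
    by (intro order.trans[OF degree_mult_le] add_mono) auto
  then show ?case using insert.hyps by simp
qed auto

text \<open>
Every complex polynomial of degree at most \<open>n\<close> with constant term 1 is of the form
\<open>\<Prod> (1 - z\<^sub>j u)\<close>: the \<open>z\<^sub>j\<close> are the inverses of its roots, filled up with zeros if the degree is
smaller than \<open>n\<close>.
\<close>

lemma fps_of_poly_eq_den:
  fixes p :: "complex poly"
  assumes "degree p \<le> n" and "coeff p 0 = 1"
  shows "\<exists>z. fps_of_poly p = den {1..n} z"
  using assms
proof (induction n arbitrary: p)
  case 0
  then have "p = 1" by (auto elim!: degree_eq_zeroE simp: one_pCons)
  then show ?case by (auto simp: den_def)
next
  case (Suc n)
  have den_Suc: "den {1..Suc n} (z(Suc n := a)) = den {1..n} z * (1 - fps_const a * fps_X)" for z a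
  proof -
    have "(\<Prod>i\<in>{1..n}. 1 - fps_const ((z(Suc n := a)) i) * fps_X) = den {1..n} z"
      unfolding den_def by (intro prod.cong) auto
    then show ?thesis by (simp add: den_def)
  qed
  show ?case
  proof (cases "degree p \<le> n")
    case True
    then obtain z where "fps_of_poly p = den {1..n} z" using Suc.IH Suc.prems by blast
    then have "fps_of_poly p = den {1..Suc n} (z(Suc n := 0))" using den_Suc[of z 0] by simp
    then show ?thesis by blast
  next
    case False
    then have "\<not> constant (poly p)" by (simp add: constant_degree)
    then obtain r where r: "poly p r = 0" using fundamental_theorem_of_algebra by blast
    have "r \<noteq> 0" using r Suc.prems by (auto simp: poly_0_coeff_0)
    from r obtain q where q: "p = [:- r, 1:] * q" by (auto simp: poly_eq_0_iff_dvd elim: dvdE)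
    define q' where "q' = Polynomial.smult (- r) q"
    have "[:- r, 1:] = Polynomial.smult (- r) [:1, - inverse r:]" using \<open>r \<noteq> 0\<close> by simp
    then have p: "p = [:1, - inverse r:] * q'"
      unfolding q q'_def by (simp only: mult_smult_left mult_smult_right)
    have "q \<noteq> 0" using q Suc.prems by auto
    have "degree p = Suc (degree q)" unfolding q using \<open>q \<noteq> 0\<close> by (subst degree_mult_eq) auto
    then have "degree q' \<le> n" using Suc.prems by (simp add: q'_def)
    moreover have "coeff q' 0 = 1" using Suc.prems p by (simp add: coeff_mult)
    ultimately obtain z where z: "fps_of_poly q' = den {1..n} z" using Suc.IH by blast
    have "fps_of_poly [:1, - inverse r:] = 1 - fps_const (inverse r) * fps_X"
      by (simp add: fps_of_poly_pCons mult.commute)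
    then have "fps_of_poly p = den {1..Suc n} (z(Suc n := inverse r))"
      unfolding den_Suc p fps_of_poly_mult z by (simp only: mult.commute)
    then show ?thesis by blast
  qed
qed

text \<open>
The values of \<open>hp\<close> in the variables \<open>x\<close> and \<open>z = - y\<close>, in which the alternating sign disappears.
\<close>

definition super_psum :: "nat \<Rightarrow> nat \<Rightarrow> (nat \<Rightarrow> complex) \<Rightarrow> (nat \<Rightarrow> complex) \<Rightarrow> nat \<Rightarrow> complex" where
  "super_psum m n x z k = (\<Sum>i=1..m. x i ^ k) - (\<Sum>j=1..n. z j ^ k)"

text \<open>
Take \<open>z\<close> with \<open>\<Prod> (1 - z\<^sub>j u) = X + t G = X (1 + t R)\<close>, where \<open>R = G / X\<close>. The series \<open>P\<close> of super
power sums is the logarithmic derivative of \<open>1 + t R\<close>, that is \<open>(1 + t R) P = t R'\<close>. As \<open>R\<close> has no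
constant term, comparing coefficients one after the other gives \<open>P = t R' + o(t)\<close>.
\<close>

lemma super_psum_first_order:
  fixes G :: "complex poly"
  assumes "m \<le> n" "degree G \<le> n" "coeff G 0 = 0"
  shows "\<exists>z. \<forall>k\<ge>1. ((\<lambda>t. super_psum m n x (z t) k / t) \<longlongrightarrow>
    of_nat k * fps_nth (fps_of_poly G * inverse (den {1..m} x)) k) (at 0)"
proof -
  define X where "X = den {1..m} x"
  define R where "R = fps_of_poly G * inverse X"
  have R0: "fps_nth R 0 = 0" using assms(3) by (simp add: R_def fps_mult_nth)
  have XR: "X * R = fps_of_poly G"
    using den_inverse[of "{1..m}" x] by (simp add: R_def X_def mult.left_commute)
  have "\<exists>z. den {1..n} z = X * (1 + fps_const t * R)" for t
  proof -
    let ?p = "(\<Prod>i\<in>{1..m}. [:1, - x i:]) + Polynomial.smult t G"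
    have "degree ?p \<le> n"
      using degree_prod_linear[of x "{1..m}"] assms
      by (intro degree_add_le) (auto intro: order.trans[OF degree_smult_le])
    moreover have "coeff ?p 0 = 1"
      using assms(3) arg_cong[OF fps_of_poly_prod_linear[of x "{1..m}"], of "\<lambda>f. fps_nth f 0"] by simp
    ultimately obtain z where "fps_of_poly ?p = den {1..n} z" using fps_of_poly_eq_den by blast
    moreover have "fps_of_poly ?p = X + fps_const t * (X * R)"
      by (simp only: fps_of_poly_add fps_of_poly_smult fps_of_poly_prod_linear X_def [symmetric] XR)
    ultimately show ?thesis by (intro exI[of _ z]) (simp add: algebra_simps)
  qed
  then obtain z where z: "\<And>t. den {1..n} (z t) = X * (1 + fps_const t * R)" by metis
  define P where "P = (\<lambda>t. Abs_fps (\<lambda>k. super_psum m n x (z t) (Suc k)))"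
  have P: "(1 + fps_const t * R) * P t = fps_const t * fps_deriv R" for t
  proof -
    define px where "px = Abs_fps (\<lambda>k. \<Sum>i=1..m. x i ^ Suc k)"
    define pz where "pz = Abs_fps (\<lambda>k. \<Sum>j=1..n. z t j ^ Suc k)"
    have P: "P t = px - pz" by (simp add: P_def px_def pz_def fps_eq_iff super_psum_def)
    have X': "fps_deriv X = - X * px" unfolding X_def px_def by (rule fps_deriv_den) simp
    have "fps_deriv (den {1..n} (z t)) = - den {1..n} (z t) * pz"
      unfolding pz_def by (rule fps_deriv_den) simp
    moreover have "fps_deriv (X * (1 + fps_const t * R)) =
        - X * px * (1 + fps_const t * R) + X * (fps_const t * fps_deriv R)"
      by (simp add: X' algebra_simps)
    ultimately have e: "- (X * (1 + fps_const t * R)) * pz =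
        - X * px * (1 + fps_const t * R) + X * (fps_const t * fps_deriv R)"
      unfolding z by simp
    have "X * ((1 + fps_const t * R) * P t) =
        - (X * (1 + fps_const t * R)) * pz + X * px * (1 + fps_const t * R)"
      unfolding P by (simp add: algebra_simps)
    also have "\<dots> = X * (fps_const t * fps_deriv R)" unfolding e by simp
    finally have "X * ((1 + fps_const t * R) * P t) = X * (fps_const t * fps_deriv R)" .
    moreover have "X \<noteq> 0" using den_nth_0[of "{1..m}" x] by (metis X_def fps_zero_nth zero_neq_one)
    ultimately show ?thesis by simp
  qed
  \<comment> \<open>the coefficients of index below k are o(1), so R P does not contribute to the limit\<close>
  have lim: "((\<lambda>t. fps_nth (P t) k / t) \<longlongrightarrow> fps_nth (fps_deriv R) k) (at 0)" for k
  proof (induction k rule: less_induct)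
    case (less k)
    have small: "((\<lambda>t. fps_nth (P t) j) \<longlongrightarrow> 0) (at 0)" if "j < k" for j
    proof -
      have "((\<lambda>t. t * (fps_nth (P t) j / t)) \<longlongrightarrow> 0 * fps_nth (fps_deriv R) j) (at 0)"
        by (intro tendsto_mult less.IH that tendsto_ident_at)
      moreover have "eventually (\<lambda>t. t * (fps_nth (P t) j / t) = fps_nth (P t) j) (at 0)"
        by (auto simp: eventually_at_filter)
      ultimately have "((\<lambda>t. fps_nth (P t) j) \<longlongrightarrow> 0 * fps_nth (fps_deriv R) j) (at 0)"
        by (rule Lim_transform_eventually)
      then show ?thesis by simp
    qed
    have "((\<lambda>t. fps_nth (fps_deriv R) k - (\<Sum>i=1..k. fps_nth R i * fps_nth (P t) (k - i)))
        \<longlongrightarrow> fps_nth (fps_deriv R) k - (\<Sum>i=1..k. fps_nth R i * 0)) (at 0)"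
      by (intro tendsto_diff tendsto_const tendsto_sum tendsto_mult small) auto
    moreover have "eventually (\<lambda>t. fps_nth (fps_deriv R) k -
        (\<Sum>i=1..k. fps_nth R i * fps_nth (P t) (k - i)) = fps_nth (P t) k / t) (at 0)"
    proof -
      have "fps_nth (fps_deriv R) k - (\<Sum>i=1..k. fps_nth R i * fps_nth (P t) (k - i))
          = fps_nth (P t) k / t" if "t \<noteq> 0" for t
      proof -
        have "P t + fps_const t * (R * P t) = fps_const t * fps_deriv R"
          using P[of t] by (simp add: algebra_simps)
        then have "fps_nth (P t) k + t * fps_nth (R * P t) k = t * fps_nth (fps_deriv R) k"
          by (metis fps_add_nth fps_mult_left_const_nth)
        moreover have "fps_nth (R * P t) k = (\<Sum>i=1..k. fps_nth R i * fps_nth (P t) (k - i))"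
          unfolding fps_mult_nth using R0 by (intro sum.mono_neutral_right) (auto simp: not_less_eq_eq)
        ultimately show ?thesis using that by (simp add: field_simps)
      qed
      then show ?thesis by (auto simp: eventually_at_filter)
    qed
    ultimately have "((\<lambda>t. fps_nth (P t) k / t) \<longlongrightarrow>
        fps_nth (fps_deriv R) k - (\<Sum>i=1..k. fps_nth R i * 0)) (at 0)"
      by (rule Lim_transform_eventually)
    then show ?case by simp
  qed
  show ?thesis
  proof (intro exI allI impI)
    fix k :: nat assume "1 \<le> k"
    then obtain k' where "k = Suc k'" by (cases k) auto
    then show "((\<lambda>t. super_psum m n x (z t) k / t) \<longlongrightarrow>
        of_nat k * fps_nth (fps_of_poly G * inverse (den {1..m} x)) k) (at 0)"
      using lim[of k', unfolded fps_deriv_nth] by (simp add: P_def R_def X_def)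
  qed
qed

section \<open>Leading terms\<close>

lemma tendsto_prod_list:
  fixes f :: "'b \<Rightarrow> 'a \<Rightarrow> complex"
  assumes "\<And>k. k \<in> set xs \<Longrightarrow> (f k \<longlongrightarrow> g k) F"
  shows "((\<lambda>t. \<Prod>k\<leftarrow>xs. f k t) \<longlongrightarrow> (\<Prod>k\<leftarrow>xs. g k)) F"
  using assms by (induction xs) (auto intro!: tendsto_mult)

text \<open>
Each factor of a product over \<open>\<lambda>\<close> contributes one power of \<open>t\<close>. After division of the relation by
\<open>t ^ l\<close> only the partitions of the minimal length \<open>l\<close> survive as \<open>t\<close> tends to 0.
\<close>

lemma super_psum_products_lowest_order:
  fixes G :: "complex poly"
  assumes "m \<le> n" "degree G \<le> n" "coeff G 0 = 0" and fin: "finite B"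
    and len: "\<And>la. la \<in> B \<Longrightarrow> l \<le> length la"
    and pos: "\<And>la k. la \<in> B \<Longrightarrow> k \<in> set la \<Longrightarrow> k \<ge> 1"
    and zero: "\<And>x z. (\<Sum>la\<in>B. c la * (\<Prod>k\<leftarrow>la. super_psum m n x z k)) = 0"
  shows "(\<Sum>la | la \<in> B \<and> length la = l. c la *
    (\<Prod>k\<leftarrow>la. of_nat k * fps_nth (fps_of_poly G * inverse (den {1..m} x)) k)) = 0"
proof -
  let ?L = "\<lambda>k. of_nat k * fps_nth (fps_of_poly G * inverse (den {1..m} x)) k"
  obtain z where z: "\<And>k. k \<ge> 1 \<Longrightarrow> ((\<lambda>t. super_psum m n x (z t) k / t) \<longlongrightarrow> ?L k) (at 0)"
    using super_psum_first_order[OF assms(1-3)] by blast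
  define f where "f = (\<lambda>t. \<Sum>la\<in>B. c la * (t ^ (length la - l) * (\<Prod>k\<leftarrow>la. super_psum m n x (z t) k / t)))"
  have lim: "(f \<longlongrightarrow> (\<Sum>la\<in>B. c la * (0 ^ (length la - l) * (\<Prod>k\<leftarrow>la. ?L k)))) (at 0)"
    unfolding f_def using z pos
    by (intro tendsto_sum tendsto_mult tendsto_const tendsto_power tendsto_ident_at tendsto_prod_list) auto
  have "f t = 0" if "t \<noteq> 0" for t
  proof -
    have "t ^ l * (t ^ (length la - l) * (\<Prod>k\<leftarrow>la. super_psum m n x (z t) k / t)) =
        (\<Prod>k\<leftarrow>la. super_psum m n x (z t) k)" if "la \<in> B" for la
    proof -
      have "(\<Prod>k\<leftarrow>la. super_psum m n x (z t) k) =
          t ^ length la * (\<Prod>k\<leftarrow>la. super_psum m n x (z t) k / t)"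
        using \<open>t \<noteq> 0\<close> by (induction la) (simp_all add: mult_ac)
      also have "t ^ length la = t ^ l * t ^ (length la - l)"
        using len[OF that] by (subst power_add [symmetric]) simp
      finally show ?thesis by simp
    qed
    then have "t ^ l * f t = (\<Sum>la\<in>B. c la * (\<Prod>k\<leftarrow>la. super_psum m n x (z t) k))"
      unfolding f_def sum_distrib_left by (intro sum.cong) (auto simp: mult.left_commute)
    then show ?thesis using zero that by simp
  qed
  then have "(f \<longlongrightarrow> 0) (at 0)"
    by (intro tendsto_eventually) (auto simp: eventually_at_filter)
  then have "0 = (\<Sum>la\<in>B. c la * (0 ^ (length la - l) * (\<Prod>k\<leftarrow>la. ?L k)))"
    by (rule tendsto_unique[OF at_neq_bot _ lim])
  also have "\<dots> = (\<Sum>la | la \<in> B \<and> length la = l. c la * (\<Prod>k\<leftarrow>la. ?L k))"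
  proof (intro sum.mono_neutral_cong_right ballI)
    fix la assume "la \<in> B - {la \<in> B. length la = l}"
    then have "length la - l \<noteq> 0" using len[of la] by auto
    then show "c la * (0 ^ (length la - l) * (\<Prod>k\<leftarrow>la. ?L k)) = 0" by simp
  qed (use fin in auto)
  finally show ?thesis by simp
qed

lemma coeff_mult_top:
  assumes "degree p \<le> a" "degree q \<le> b"
  shows "coeff (p * q) (a + b) = coeff p a * coeff q b"
proof -
  have "coeff (p * q) (a + b) = (\<Sum>i\<le>a + b. coeff p i * coeff q (a + b - i))"
    by (rule coeff_mult)
  also have "\<dots> = (\<Sum>i\<in>{a}. coeff p i * coeff q (a + b - i))"
  proof (intro sum.mono_neutral_right ballI)
    fix i assume "i \<in> {..a + b} - {a}"
    then have "degree p < i \<or> degree q < a + b - i" using assms by auto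
    then show "coeff p i * coeff q (a + b - i) = 0" by (auto simp: coeff_eq_0)
  qed auto
  finally show ?thesis by simp
qed

lemma prod_list_top_coeff:
  fixes q :: "'b \<Rightarrow> complex poly"
  assumes "\<And>k. k \<in> set xs \<Longrightarrow> degree (q k) \<le> d k"
  shows "degree (\<Prod>k\<leftarrow>xs. q k) \<le> (\<Sum>k\<leftarrow>xs. d k) \<and>
    coeff (\<Prod>k\<leftarrow>xs. q k) (\<Sum>k\<leftarrow>xs. d k) = (\<Prod>k\<leftarrow>xs. coeff (q k) (d k))"
  using assms
proof (induction xs)
  case (Cons k xs)
  have IH: "degree (\<Prod>k\<leftarrow>xs. q k) \<le> (\<Sum>k\<leftarrow>xs. d k)"
    "coeff (\<Prod>k\<leftarrow>xs. q k) (\<Sum>k\<leftarrow>xs. d k) = (\<Prod>k\<leftarrow>xs. coeff (q k) (d k))"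
    using Cons.IH Cons.prems by (meson list.set_intros(2))+
  have k: "degree (q k) \<le> d k" using Cons.prems by simp
  show ?case
    using coeff_mult_top[OF k IH(1)] order.trans[OF degree_mult_le add_mono[OF k IH(1)]] IH(2)
    by simp
qed simp

text \<open>
Uniqueness of the representation in base \<open>b\<close>, read as follows: a multiset of fewer than \<open>b\<close>
exponents is determined by the sum of the corresponding powers of \<open>b\<close>. The largest exponents
agree, because fewer than \<open>b\<close> copies of a smaller power cannot reach the next one.
\<close>

lemma sum_powers_inj:
  fixes b :: nat
  assumes "sorted_wrt (\<ge>) xs" "sorted_wrt (\<ge>) ys" "length xs = length ys" "length xs < b"
    and "(\<Sum>k\<leftarrow>xs. b ^ k) = (\<Sum>k\<leftarrow>ys. b ^ k)"
  shows "xs = ys"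
  using assms
proof (induction xs arbitrary: ys)
  case (Cons u xs)
  from Cons.prems(3) obtain v ys' where ys: "ys = v # ys'" by (cases ys) auto
  have less: "(\<Sum>k\<leftarrow>t # ts. b ^ k) < (\<Sum>k\<leftarrow>w # ws. b ^ k)"
    if "sorted_wrt (\<ge>) (t # ts)" "length (t # ts) < b" "t < w" for t w ts ws
  proof -
    have "b \<ge> 1" using that(2) by simp
    have "(\<Sum>k\<leftarrow>t # ts. b ^ k) \<le> (\<Sum>k\<leftarrow>t # ts. b ^ t)"
      using that(1) \<open>b \<ge> 1\<close> by (intro sum_list_mono) (auto intro: power_increasing)
    also have "\<dots> = length (t # ts) * b ^ t" by (simp add: sum_list_triv)
    also have "\<dots> < b * b ^ t" using that(2) \<open>b \<ge> 1\<close> by (intro mult_strict_right_mono) auto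
    also have "\<dots> = b ^ Suc t" by simp
    also have "\<dots> \<le> b ^ w" using that(3) \<open>b \<ge> 1\<close> by (intro power_increasing) auto
    also have "\<dots> \<le> (\<Sum>k\<leftarrow>w # ws. b ^ k)" by simp
    finally show ?thesis .
  qed
  have "u = v"
  proof (rule ccontr)
    assume "u \<noteq> v"
    then consider "u < v" | "v < u" by linarith
    then show False
    proof cases
      case 1
      then show False using less[of u xs v ys'] Cons.prems unfolding ys by simp
    next
      case 2
      then show False using less[of v ys' u xs] Cons.prems unfolding ys by simp
    qed
  qed
  moreover from this have "xs = ys'" using Cons.prems unfolding ys by (intro Cons.IH) auto
  ultimately show ?case by (simp add: ys)
qed simp

section \<open>Independence of the products of super power sums\<close>

lemma finite_partitions: "finite (partitions r)"
proof (rule finite_subset)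
  have "length la \<le> sum_list la" if "\<forall>k\<in>set la. k > 0" for la :: "nat list"
    using that by (induction la) auto
  then show "partitions r \<subseteq> {la. set la \<subseteq> {..r} \<and> length la \<le> r}"
    by (auto simp: partitions_def member_le_sum_list)
qed (rule finite_lists_length_le, simp)

lemma finite_hook: "finite (hook a b r)"
  using finite_partitions by (simp add: hook_def)

lemma prod_list_map_nth: "(\<Prod>k\<leftarrow>xs. f k) = (\<Prod>i<length xs. f (xs ! i))"
  for f :: "'a \<Rightarrow> 'b::comm_monoid_mult"
  using prod.list_conv_set_nth[of "map f xs"] by (simp add: atLeast0LessThan)

text \<open>
The amounts by which the first \<open>m\<close> parts exceed \<open>n\<close>. By the hook condition the remaining parts do
not exceed \<open>n\<close>.
\<close>

definition excess :: "nat \<Rightarrow> nat \<Rightarrow> nat list \<Rightarrow> nat list" where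
  "excess m n la = map (\<lambda>i. part la (Suc i) - n) [0..<m]"

lemma part_mono:
  assumes "sorted_wrt (\<ge>) la" "1 \<le> i" "i \<le> j"
  shows "part la j \<le> part la i"
  using assms sorted_wrt_nth_less[OF assms(1), of "i - 1" "j - 1"]
  by (cases "i = j") (auto simp: part_def)

lemma part_Suc: "part la (Suc i) = (if i < length la then la ! i else 0)"
  by (auto simp: part_def)

lemma hook_part_le:
  assumes "la \<in> hook m n r" "m \<le> i"
  shows "part la (Suc i) \<le> n"
  using part_mono[of la "m + 1" "Suc i"] assms by (auto simp: hook_def partitions_def)

lemma prod_list_excess:
  fixes h :: "nat \<Rightarrow> complex"
  assumes la: "la \<in> hook m n r" and "h 0 = 1"
  shows "(\<Prod>k\<leftarrow>la. h (k - n)) = (\<Prod>k\<leftarrow>excess m n la. h k)"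
proof -
  let ?N = "max m (length la)"
  have "(\<Prod>k\<leftarrow>la. h (k - n)) = (\<Prod>i<length la. h (part la (Suc i) - n))"
    by (simp add: prod_list_map_nth part_Suc)
  also have "\<dots> = (\<Prod>i<?N. h (part la (Suc i) - n))"
    using assms(2) by (intro prod.mono_neutral_left) (auto simp: part_Suc)
  also have "\<dots> = (\<Prod>i<m. h (part la (Suc i) - n))"
    using assms hook_part_le[OF la] by (intro prod.mono_neutral_right) auto
  also have "\<dots> = (\<Prod>k\<leftarrow>excess m n la. h k)"
    by (simp add: prod_list_map_nth excess_def)
  finally show ?thesis .
qed

lemma sum_excess:
  assumes la: "la \<in> hook m n r"
  shows "sum_list (excess m n la) + (\<Sum>k\<leftarrow>la. min n k) = r"
proof -
  let ?N = "max m (length la)"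
  have sum_nth: "(\<Sum>k\<leftarrow>la. f k) = (\<Sum>i<length la. f (la ! i))" for f :: "nat \<Rightarrow> nat"
    by (simp add: sum_list_sum_nth atLeast0LessThan)
  have "(\<Sum>k\<leftarrow>la. k - n) = (\<Sum>i<length la. part la (Suc i) - n)"
    by (simp add: sum_nth part_Suc)
  also have "\<dots> = (\<Sum>i<?N. part la (Suc i) - n)"
    by (intro sum.mono_neutral_left) (auto simp: part_Suc)
  also have "\<dots> = (\<Sum>i<m. part la (Suc i) - n)"
    using assms hook_part_le[OF la] by (intro sum.mono_neutral_right) auto
  also have "\<dots> = sum_list (excess m n la)"
    by (simp add: sum_list_sum_nth excess_def atLeast0LessThan)
  finally have "sum_list (excess m n la) + (\<Sum>k\<leftarrow>la. min n k) = (\<Sum>k\<leftarrow>la. (k - n) + min n k)"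
    by (simp add: sum_list_addf)
  also have "(\<lambda>k. (k - n) + min n k) = (\<lambda>k. k)" by auto
  finally show ?thesis using la by (simp add: hook_def partitions_def)
qed

lemma excess_inj:
  assumes "la \<in> hook m n r" "mu \<in> hook m n r" "map (min n) la = map (min n) mu"
    and "excess m n la = excess m n mu"
  shows "la = mu"
proof (rule nth_equalityI)
  show len: "length la = length mu" using assms(3) by (metis length_map)
  fix i assume i: "i < length la"
  have "min n (la ! i) = min n (mu ! i)" using assms(3) i len by (metis nth_map)
  moreover have "la ! i - n = mu ! i - n"
  proof (cases "i < m")
    case True
    then show ?thesis using arg_cong[OF assms(4), of "\<lambda>xs. xs ! i"] i len
      by (simp add: excess_def part_Suc)
  next
    case False
    then show ?thesis
      using hook_part_le[OF assms(1), of i] hook_part_le[OF assms(2), of i] i len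
      by (simp add: part_Suc)
  qed
  ultimately show "la ! i = mu ! i" by (auto simp: min_def split: if_splits)
qed

lemma excess_padded:
  assumes "la \<in> hook m n r"
  shows "excess m n la \<in> padded_partitions m (r - (\<Sum>k\<leftarrow>la. min n k))"
proof -
  have "sorted_wrt (\<ge>) la" using assms by (simp add: hook_def partitions_def)
  then have "sorted_wrt (\<ge>) (excess m n la)"
    by (auto simp: excess_def sorted_wrt_iff_nth_less intro!: diff_le_mono part_mono)
  then show ?thesis
    using sum_excess[OF assms] by (auto simp: padded_partitions_def excess_def)
qed

text \<open>
In a nontrivial relation keep first the partitions of minimal length (\<open>C\<close>, the lowest order in
\<open>t\<close>) and then, with \<open>g\<^sub>j = s ^ (b ^ j)\<close>, those whose contribution has the largest degree in \<open>s\<close>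
(\<open>E\<close>). The factor of a part \<open>k\<close> has the leading term \<open>k h\<^sub>k\<^sub>-\<^sub>n(x) s ^ (b ^ min n k)\<close>, where
\<open>k - n\<close> is truncated. For \<open>b\<close> larger than the number of parts the degree determines all the
numbers \<open>min n k\<close>. So the members of \<open>E\<close> are distinguished by their excesses, and the independence
of the products \<open>h\<^sub>\<mu>\<close> applies.
\<close>

lemma super_psum_products_independent:
  assumes n: "1 \<le> n" "m \<le> n" and A: "A \<subseteq> hook m n r"
    and zero: "\<And>x z. (\<Sum>la\<in>A. c la * (\<Prod>k\<leftarrow>la. super_psum m n x z k)) = 0"
    and "la0 \<in> A"
  shows "c la0 = 0"
proof (rule ccontr)
  assume "c la0 \<noteq> 0"
  have finA: "finite A" using A finite_hook finite_subset by blast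
  define B where "B = {la \<in> A. c la \<noteq> 0}"
  have B: "finite B" "B \<noteq> {}" using finA \<open>la0 \<in> A\<close> \<open>c la0 \<noteq> 0\<close> by (auto simp: B_def)
  have zeroB: "(\<Sum>la\<in>B. c la * (\<Prod>k\<leftarrow>la. super_psum m n x z k)) = 0" for x z
  proof -
    have "(\<Sum>la\<in>B. c la * (\<Prod>k\<leftarrow>la. super_psum m n x z k)) =
        (\<Sum>la\<in>A. c la * (\<Prod>k\<leftarrow>la. super_psum m n x z k))"
      using finA by (intro sum.mono_neutral_left) (auto simp: B_def)
    then show ?thesis using zero by simp
  qed
  have hookB: "la \<in> hook m n r" if "la \<in> B" for la using that A by (auto simp: B_def)
  have sortB: "sorted_wrt (\<ge>) la" and posB: "k \<in> set la \<Longrightarrow> k \<ge> 1" if "la \<in> B" for la k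
    using hookB[OF that] by (auto simp: hook_def partitions_def Suc_le_eq)
  define l where "l = Min (length ` B)"
  have l: "l \<le> length la" if "la \<in> B" for la using that B by (simp add: l_def)
  define C where "C = {la \<in> B. length la = l}"
  have "l \<in> length ` B" unfolding l_def using B by (intro Min_in) auto
  then have C: "finite C" "C \<noteq> {}" using B by (auto simp: C_def)
  define b where "b = l + 2"
  \<comment> \<open>the degree in s of the product belonging to la\<close>
  define W where "W = (\<lambda>la. \<Sum>k\<leftarrow>la. b ^ min n k)"
  define D where "D = Max (W ` C)"
  have WD: "W la \<le> D" if "la \<in> C" for la using that C by (simp add: D_def)
  define E where "E = {la \<in> C. W la = D}"
  have "D \<in> W ` C" unfolding D_def using C by (intro Max_in) auto
  then obtain la1 where la1: "la1 \<in> E" by (auto simp: E_def)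
  have EB: "la \<in> B" if "la \<in> E" for la using that by (simp add: E_def C_def)
  have finE: "finite E" using C by (simp add: E_def)
  have sumE: "(\<Sum>la\<in>E. c la * (\<Prod>k\<leftarrow>la. of_nat k * hsym m x (k - n))) = 0" for x
  proof -
    \<comment> \<open>k times the coefficient of u^k in G / X, as a polynomial in s\<close>
    define q where "q = (\<lambda>k. \<Sum>j\<in>{1..min n k}. Polynomial.monom (of_nat k * hsym m x (k - j)) (b ^ j))"
    have degq: "degree (q k) \<le> b ^ min n k" for k
      unfolding q_def
    proof (rule degree_sum_le)
      fix j assume "j \<in> {1..min n k}"
      then have "b ^ j \<le> b ^ min n k" by (intro power_increasing) (auto simp: b_def)
      then show "degree (Polynomial.monom (of_nat k * hsym m x (k - j)) (b ^ j)) \<le> b ^ min n k"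
        by (rule order.trans[OF degree_monom_le])
    qed simp
    have topq: "coeff (q k) (b ^ min n k) = of_nat k * hsym m x (k - n)" if "k \<ge> 1" for k
    proof -
      have "coeff (q k) (b ^ min n k) =
          (\<Sum>j\<in>{1..min n k}. if j = min n k then of_nat k * hsym m x (k - j) else 0)"
        unfolding q_def coeff_sum by (intro sum.cong) (auto simp: b_def)
      also have "\<dots> = of_nat k * hsym m x (k - min n k)" using that n by simp
      also have "k - min n k = k - n" by auto
      finally show ?thesis .
    qed
    define P where "P = (\<Sum>la\<in>C. Polynomial.smult (c la) (\<Prod>k\<leftarrow>la. q k))"
    have "poly P s = 0" for s
    proof -
      define G where "G = (\<Sum>j=1..n. Polynomial.monom (s ^ (b ^ j)) j)"
      have q: "of_nat k * fps_nth (fps_of_poly G * inverse (den {1..m} x)) k = poly (q k) s" for k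
      proof -
        have "fps_nth (fps_of_poly G * inverse (den {1..m} x)) k =
            (\<Sum>j=1..n. if k < j then 0 else s ^ (b ^ j) * hsym m x (k - j))"
          by (simp add: G_def fps_of_poly_sum fps_of_poly_monom sum_distrib_right fps_sum_nth
              mult.assoc fps_X_power_mult_nth hsym_def if_distrib cong: if_cong)
        also have "\<dots> = (\<Sum>j\<in>{1..min n k}. s ^ (b ^ j) * hsym m x (k - j))"
          by (intro sum.mono_neutral_cong_right) auto
        finally show ?thesis
          by (simp add: q_def poly_sum poly_monom sum_distrib_left mult_ac)
      qed
      have "degree G \<le> n" unfolding G_def
        by (intro degree_sum_le) (auto intro: order.trans[OF degree_monom_le])
      moreover have "coeff G 0 = 0" by (simp add: G_def coeff_sum)
      ultimately have "(\<Sum>la | la \<in> B \<and> length la = l. c la *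
          (\<Prod>k\<leftarrow>la. of_nat k * fps_nth (fps_of_poly G * inverse (den {1..m} x)) k)) = 0"
        using n(2) B(1) l posB zeroB by (intro super_psum_products_lowest_order) auto
      then have "(\<Sum>la\<in>C. c la * (\<Prod>k\<leftarrow>la. poly (q k) s)) = 0"
        unfolding q C_def .
      moreover have "poly (\<Prod>k\<leftarrow>la. q k) s = (\<Prod>k\<leftarrow>la. poly (q k) s)" for la
        by (induction la) auto
      ultimately show ?thesis by (simp add: P_def poly_sum)
    qed
    then have "P = 0" using poly_all_0_iff_0 by blast
    then have "0 = coeff P D" by simp
    also have "\<dots> = (\<Sum>la\<in>C. c la * coeff (\<Prod>k\<leftarrow>la. q k) D)"
      by (simp add: P_def coeff_sum)
    also have "\<dots> = (\<Sum>la\<in>E. c la * (\<Prod>k\<leftarrow>la. of_nat k * hsym m x (k - n)))"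
    proof (rule sum.mono_neutral_cong_right)
      show "\<forall>la\<in>C - E. c la * coeff (\<Prod>k\<leftarrow>la. q k) D = 0"
      proof
        fix la assume "la \<in> C - E"
        then have "W la < D" using WD by (auto simp: E_def le_less)
        moreover have "degree (\<Prod>k\<leftarrow>la. q k) \<le> W la"
          using prod_list_top_coeff[of la q "\<lambda>k. b ^ min n k"] degq by (simp add: W_def)
        ultimately show "c la * coeff (\<Prod>k\<leftarrow>la. q k) D = 0" by (simp add: coeff_eq_0)
      qed
      fix la assume la: "la \<in> E"
      then have "coeff (\<Prod>k\<leftarrow>la. q k) D = (\<Prod>k\<leftarrow>la. coeff (q k) (b ^ min n k))"
        using prod_list_top_coeff[of la q "\<lambda>k. b ^ min n k"] degq by (simp add: W_def E_def)
      also have "map (\<lambda>k. coeff (q k) (b ^ min n k)) la = map (\<lambda>k. of_nat k * hsym m x (k - n)) la"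
        using topq posB[OF EB[OF la]] by simp
      finally show "c la * coeff (\<Prod>k\<leftarrow>la. q k) D =
          c la * (\<Prod>k\<leftarrow>la. of_nat k * hsym m x (k - n))" by simp
    qed (use C in \<open>auto simp: E_def\<close>)
    finally show ?thesis by simp
  qed
  have minE: "map (min n) la = map (min n) la1" if la: "la \<in> E" for la
  proof (rule sum_powers_inj[of _ _ b])
    have "sorted_wrt (\<ge>) (map (min n) mu)" if "mu \<in> B" for mu
      using sortB[OF that] by (auto simp: sorted_wrt_map elim!: sorted_wrt_mono_rel[rotated])
    then show "sorted_wrt (\<ge>) (map (min n) la)" "sorted_wrt (\<ge>) (map (min n) la1)"
      using EB la la1 by blast+
  qed (use la la1 in \<open>auto simp: E_def C_def b_def W_def o_def\<close>)
  define d where "d = r - (\<Sum>k\<leftarrow>la1. min n k)"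
  have paddedE: "excess m n la \<in> padded_partitions m d" if "la \<in> E" for la
    using excess_padded[OF hookB[OF EB[OF that]]] minE[OF that] by (simp add: d_def)
  define c' where "c' = (\<lambda>mu. \<Sum>la | la \<in> E \<and> excess m n la = mu. c la * (\<Prod>k\<leftarrow>la. of_nat k))"
  have "c' (excess m n la1) = 0"
  proof (rule hsym_products_independent[where m = m and d = d])
    fix x
    have "(\<Sum>mu\<in>padded_partitions m d. c' mu * (\<Prod>k\<leftarrow>mu. hsym m x k)) =
        (\<Sum>mu\<in>padded_partitions m d. \<Sum>la | la \<in> E \<and> excess m n la = mu.
          c la * (\<Prod>k\<leftarrow>la. of_nat k) * (\<Prod>k\<leftarrow>excess m n la. hsym m x k))"
      unfolding c'_def sum_distrib_right by (intro sum.cong) auto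
    also have "\<dots> = (\<Sum>la\<in>E. c la * (\<Prod>k\<leftarrow>la. of_nat k) * (\<Prod>k\<leftarrow>excess m n la. hsym m x k))"
      using finE finite_padded_partitions paddedE by (intro sum.group) auto
    also have "\<dots> = (\<Sum>la\<in>E. c la * (\<Prod>k\<leftarrow>la. of_nat k * hsym m x (k - n)))"
    proof (intro sum.cong refl)
      fix la assume "la \<in> E"
      then have "(\<Prod>k\<leftarrow>excess m n la. hsym m x k) = (\<Prod>k\<leftarrow>la. hsym m x (k - n))"
        using prod_list_excess[OF hookB[OF EB], of la "hsym m x"] by (simp add: hsym_def)
      then show "c la * (\<Prod>k\<leftarrow>la. of_nat k) * (\<Prod>k\<leftarrow>excess m n la. hsym m x k) =
          c la * (\<Prod>k\<leftarrow>la. of_nat k * hsym m x (k - n))"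
        by (simp add: prod_list_map_nth prod.distrib mult.assoc)
    qed
    finally show "(\<Sum>mu\<in>padded_partitions m d. c' mu * (\<Prod>k\<leftarrow>mu. hsym m x k)) = 0"
      using sumE by simp
  qed (rule paddedE[OF la1])
  moreover have "{la. la \<in> E \<and> excess m n la = excess m n la1} = {la1}"
    using excess_inj[OF hookB[OF EB] hookB[OF EB[OF la1]] minE] la1 by blast
  ultimately have "c la1 * (\<Prod>k\<leftarrow>la1. of_nat k) = 0" by (simp add: c'_def)
  moreover have "(\<Prod>k\<leftarrow>la1. of_nat k) \<noteq> (0::complex)"
    using posB[OF EB[OF la1], of 0] by (auto simp: prod_list_zero_iff)
  moreover have "c la1 \<noteq> 0" using EB[OF la1] by (simp add: B_def)
  ultimately show False by simp
qed


text \<open>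
The case \<open>n < m\<close> reduces to the previous one by exchanging \<open>x\<close> and \<open>z\<close>, which multiplies each
\<open>p\<^sub>k\<close> by \<open>-1\<close>.
\<close>

lemma super_psum_products_independent_dual:
  assumes mn: "1 \<le> m" "1 \<le> n"
    and zero: "\<And>x z. (\<Sum>la\<in>hook_dual m n r. c la * (\<Prod>k\<leftarrow>la. super_psum m n x z k)) = 0"
    and la: "la \<in> hook_dual m n r"
  shows "c la = 0"
proof (cases "m \<le> n")
  case True
  then have "hook_dual m n r = hook m n r" by (simp add: hook_dual_def)
  then show ?thesis
    using super_psum_products_independent[where r = r and c = c, OF mn(2) True subset_refl] zero la by simp
next
  case False
  then have dual: "hook_dual m n r = hook n m r" by (simp add: hook_dual_def)
  have swap: "(\<Prod>k\<leftarrow>mu. super_psum m n z x k) = (- 1) ^ length mu * (\<Prod>k\<leftarrow>mu. super_psum n m x z k)"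
    for x z and mu :: "nat list"
  proof (induction mu)
    case (Cons k mu)
    have "super_psum m n z x k = - super_psum n m x z k" by (simp add: super_psum_def)
    then show ?case using Cons by simp
  qed simp
  have "c la * (- 1) ^ length la = 0"
  proof (rule super_psum_products_independent[where r = r and c = "\<lambda>la. c la * (- 1) ^ length la",
        OF mn(1) _ subset_refl])
    fix x z
    show "(\<Sum>mu\<in>hook n m r. c mu * (- 1) ^ length mu * (\<Prod>k\<leftarrow>mu. super_psum n m x z k)) = 0"
      using zero[of z x] by (simp add: dual swap mult.assoc)
  qed (use False la dual in auto)
  then show ?thesis by simp
qed

section \<open>Evaluation of polynomials\<close>

text \<open>
The substitution \<open>\<sigma>\<close>, with coefficients mapped by \<open>h\<close>. Both \<open>msubst\<close> (with \<open>h = mconst\<close>) and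
evaluation at a complex point (with \<open>h\<close> the identity) are instances, so that the homomorphism laws
are proved once. The laws hold when \<open>h\<close> is a unital ring homomorphism.
\<close>

definition peval :: "(complex \<Rightarrow> 'b::comm_ring_1) \<Rightarrow> (var \<Rightarrow> 'b) \<Rightarrow> mpoly \<Rightarrow> 'b" where
  "peval h \<sigma> f = (\<Sum>\<mu>\<in>Poly_Mapping.keys f. h (Poly_Mapping.lookup f \<mu>) *
     (\<Prod>v\<in>Poly_Mapping.keys \<mu>. \<sigma> v ^ Poly_Mapping.lookup \<mu> v))"

definition coeff_hom :: "(complex \<Rightarrow> 'b::comm_ring_1) \<Rightarrow> bool" where
  "coeff_hom h \<longleftrightarrow> h 0 = 0 \<and> h 1 = 1 \<and> (\<forall>a b. h (a + b) = h a + h b) \<and> (\<forall>a b. h (a * b) = h a * h b)"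

lemma coeff_hom_mconst: "coeff_hom mconst"
  by (simp add: coeff_hom_def mconst_def single_add mult_single)

lemma coeff_hom_id: "coeff_hom (\<lambda>c. c)"
  by (simp add: coeff_hom_def)

lemma msubst_peval: "msubst = peval mconst"
  by (intro ext) (simp add: msubst_def peval_def)

lemma peval_superset:
  assumes "coeff_hom h" "finite M" "Poly_Mapping.keys f \<subseteq> M"
  shows "peval h \<sigma> f = (\<Sum>\<mu>\<in>M. h (Poly_Mapping.lookup f \<mu>) *
     (\<Prod>v\<in>Poly_Mapping.keys \<mu>. \<sigma> v ^ Poly_Mapping.lookup \<mu> v))"
  unfolding peval_def using assms
  by (intro sum.mono_neutral_left) (auto simp: coeff_hom_def in_keys_iff)

lemma peval_add:
  assumes "coeff_hom h"
  shows "peval h \<sigma> (f + g) = peval h \<sigma> f + peval h \<sigma> g"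
proof -
  let ?M = "Poly_Mapping.keys f \<union> Poly_Mapping.keys g"
  have "Poly_Mapping.keys (f + g) \<subseteq> ?M" by (rule keys_add)
  then show ?thesis
    using assms
    by (simp add: peval_superset[OF assms, of ?M] lookup_add coeff_hom_def distrib_right sum.distrib)
qed

lemma peval_0 [simp]: "peval h \<sigma> 0 = 0"
  by (simp add: peval_def)

lemma peval_sum:
  assumes "coeff_hom h"
  shows "peval h \<sigma> (\<Sum>i\<in>I. f i) = (\<Sum>i\<in>I. peval h \<sigma> (f i))"
  by (induction I rule: infinite_finite_induct) (simp_all add: peval_add[OF assms])

lemma prod_keys_superset:
  fixes \<sigma> :: "var \<Rightarrow> 'b::comm_ring_1"
  assumes "finite V" "Poly_Mapping.keys \<mu> \<subseteq> V"
  shows "(\<Prod>v\<in>Poly_Mapping.keys \<mu>. \<sigma> v ^ Poly_Mapping.lookup \<mu> v) =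
    (\<Prod>v\<in>V. \<sigma> v ^ Poly_Mapping.lookup \<mu> v)"
  using assms by (intro prod.mono_neutral_left) (auto simp: in_keys_iff)

lemma peval_single:
  assumes "coeff_hom h"
  shows "peval h \<sigma> (Poly_Mapping.single \<mu> c) =
    h c * (\<Prod>v\<in>Poly_Mapping.keys \<mu>. \<sigma> v ^ Poly_Mapping.lookup \<mu> v)"
  using assms peval_superset[OF assms, of "{\<mu>}" "Poly_Mapping.single \<mu> c" \<sigma>] by (simp add: keys_single)

lemma sum_single_lookup:
  fixes f :: "'a \<Rightarrow>\<^sub>0 'b::comm_monoid_add"
  shows "(\<Sum>\<mu>\<in>Poly_Mapping.keys f. Poly_Mapping.single \<mu> (Poly_Mapping.lookup f \<mu>)) = f"
proof (rule poly_mapping_eqI)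
  fix \<nu>
  have "Poly_Mapping.lookup (\<Sum>\<mu>\<in>Poly_Mapping.keys f. Poly_Mapping.single \<mu> (Poly_Mapping.lookup f \<mu>)) \<nu> =
      (\<Sum>\<mu>\<in>Poly_Mapping.keys f. if \<mu> = \<nu> then Poly_Mapping.lookup f \<mu> else 0)"
    by (simp add: lookup_sum lookup_single when_def)
  then show "Poly_Mapping.lookup (\<Sum>\<mu>\<in>Poly_Mapping.keys f. Poly_Mapping.single \<mu> (Poly_Mapping.lookup f \<mu>)) \<nu> =
      Poly_Mapping.lookup f \<nu>"
    by (simp add: in_keys_iff)
qed

lemma peval_mult:
  assumes "coeff_hom h"
  shows "peval h \<sigma> (f * g) = peval h \<sigma> f * peval h \<sigma> g"
proof -
  let ?s = "\<lambda>f \<mu>. Poly_Mapping.single \<mu> (Poly_Mapping.lookup f \<mu>)"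
  have single: "peval h \<sigma> (Poly_Mapping.single \<mu> a * Poly_Mapping.single \<nu> b) =
      peval h \<sigma> (Poly_Mapping.single \<mu> a) * peval h \<sigma> (Poly_Mapping.single \<nu> b)" for \<mu> \<nu> a b
  proof -
    let ?V = "Poly_Mapping.keys \<mu> \<union> Poly_Mapping.keys \<nu>"
    have "(\<Prod>v\<in>Poly_Mapping.keys (\<mu> + \<nu>). \<sigma> v ^ Poly_Mapping.lookup (\<mu> + \<nu>) v) =
        (\<Prod>v\<in>?V. \<sigma> v ^ Poly_Mapping.lookup (\<mu> + \<nu>) v)"
      by (intro prod_keys_superset keys_add) auto
    also have "\<dots> = (\<Prod>v\<in>?V. \<sigma> v ^ Poly_Mapping.lookup \<mu> v) * (\<Prod>v\<in>?V. \<sigma> v ^ Poly_Mapping.lookup \<nu> v)"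
      by (simp add: lookup_add power_add prod.distrib)
    also have "\<dots> = (\<Prod>v\<in>Poly_Mapping.keys \<mu>. \<sigma> v ^ Poly_Mapping.lookup \<mu> v) *
        (\<Prod>v\<in>Poly_Mapping.keys \<nu>. \<sigma> v ^ Poly_Mapping.lookup \<nu> v)"
      by (intro arg_cong2[where f = times] prod_keys_superset[symmetric]) auto
    finally show ?thesis
      using assms by (simp add: mult_single peval_single[OF assms] coeff_hom_def mult_ac)
  qed
  have "peval h \<sigma> (f * g) = peval h \<sigma> ((\<Sum>\<mu>\<in>Poly_Mapping.keys f. ?s f \<mu>) * (\<Sum>\<nu>\<in>Poly_Mapping.keys g. ?s g \<nu>))"
    by (simp only: sum_single_lookup)
  also have "\<dots> = (\<Sum>\<mu>\<in>Poly_Mapping.keys f. peval h \<sigma> (?s f \<mu>)) * (\<Sum>\<nu>\<in>Poly_Mapping.keys g. peval h \<sigma> (?s g \<nu>))"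
    by (simp add: sum_product peval_sum[OF assms] single)
  also have "\<dots> = peval h \<sigma> f * peval h \<sigma> g"
    by (simp only: peval_sum[OF assms, symmetric] sum_single_lookup)
  finally show ?thesis .
qed

lemma peval_1 [simp]: "coeff_hom h \<Longrightarrow> peval h \<sigma> 1 = 1"
  using peval_single[of h \<sigma> 0 1] by (simp add: coeff_hom_def)

lemma peval_mvar [simp]: "coeff_hom h \<Longrightarrow> peval h \<sigma> (mvar v) = \<sigma> v"
  by (simp add: mvar_def peval_single) (simp add: coeff_hom_def)

lemma peval_mconst [simp]: "coeff_hom h \<Longrightarrow> peval h \<sigma> (mconst c) = h c"
  by (simp add: mconst_def peval_single)

lemma peval_uminus:
  assumes "coeff_hom h"
  shows "peval h \<sigma> (- f) = - peval h \<sigma> f"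
  using peval_add[OF assms, of \<sigma> f "- f"] by (simp add: eq_neg_iff_add_eq_0 add.commute)

lemma peval_power: "coeff_hom h \<Longrightarrow> peval h \<sigma> (f ^ k) = peval h \<sigma> f ^ k"
  by (induction k) (simp_all add: peval_mult)

lemma peval_prod: "coeff_hom h \<Longrightarrow> peval h \<sigma> (\<Prod>i\<in>I. f i) = (\<Prod>i\<in>I. peval h \<sigma> (f i))"
  by (induction I rule: infinite_finite_induct) (simp_all add: peval_mult)

lemma peval_prod_list: "coeff_hom h \<Longrightarrow> peval h \<sigma> (\<Prod>k\<leftarrow>ks. f k) = (\<Prod>k\<leftarrow>ks. peval h \<sigma> (f k))"
  by (induction ks) (simp_all add: peval_mult)

lemma peval_msubst:
  assumes "coeff_hom h"
  shows "peval h \<rho> (msubst \<sigma> f) = peval h (\<lambda>v. peval h \<rho> (\<sigma> v)) f"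
  unfolding msubst_def
  by (simp add: peval_sum peval_mult peval_prod peval_power assms peval_def[of _ _ f])

lemma peval_cong:
  assumes "\<And>v. v \<in> mvars f \<Longrightarrow> \<sigma> v = \<tau> v"
  shows "peval h \<sigma> f = peval h \<tau> f"
  unfolding peval_def
  by (intro sum.cong arg_cong2[where f = times] refl prod.cong arg_cong2[where f = power])
    (use assms in \<open>auto simp: mvars_def\<close>)

abbreviation meval :: "(var \<Rightarrow> complex) \<Rightarrow> mpoly \<Rightarrow> complex" where
  "meval \<equiv> peval (\<lambda>c. c)"

lemmas peval_hom_simps = peval_add peval_mult peval_sum peval_power peval_uminus peval_prod_list

lemma peval_hp:
  "coeff_hom h \<Longrightarrow> peval h \<sigma> (hp m n k) =
    (\<Sum>i=1..m. \<sigma> (X i) ^ k) + (- 1) ^ (k - 1) * (\<Sum>j=1..n. \<sigma> (Y j) ^ k)"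
  by (simp add: hp_def peval_hom_simps)

lemma peval_hp_part:
  "coeff_hom h \<Longrightarrow> peval h \<sigma> (hp_part m n la) = (\<Prod>k\<leftarrow>la. peval h \<sigma> (hp m n k))"
  by (simp add: hp_part_def peval_prod_list)

section \<open>The products of power sums are supersymmetric\<close>

lemma mvars_add: "mvars (f + g) \<subseteq> mvars f \<union> mvars g"
  using keys_add[of f g] by (auto simp: mvars_def)

lemma mvars_mult: "mvars (f * g) \<subseteq> mvars f \<union> mvars g"
proof
  fix v assume "v \<in> mvars (f * g)"
  then obtain \<mu> where \<mu>: "\<mu> \<in> Poly_Mapping.keys (f * g)" "v \<in> Poly_Mapping.keys \<mu>" by (auto simp: mvars_def)
  then obtain a b where ab: "\<mu> = a + b" "a \<in> Poly_Mapping.keys f" "b \<in> Poly_Mapping.keys g"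
    using keys_mult[of f g] by blast
  then have "v \<in> Poly_Mapping.keys a \<union> Poly_Mapping.keys b" using \<mu>(2) keys_add[of a b] by auto
  then show "v \<in> mvars f \<union> mvars g" using ab by (auto simp: mvars_def)
qed

lemma mvars_0 [simp]: "mvars 0 = {}" and mvars_1 [simp]: "mvars 1 = {}"
  and mvars_mvar: "mvars (mvar v) = {v}" and mvars_mconst [simp]: "mvars (mconst c) = {}"
  by (auto simp: mvars_def mvar_def mconst_def)

lemma mvars_uminus [simp]: "mvars (- f) = mvars f"
  by (simp add: mvars_def in_keys_iff set_eq_iff)

lemma mvars_power: "mvars (f ^ k) \<subseteq> mvars f"
proof (induction k)
  case (Suc k)
  then show ?case using mvars_mult[of f "f ^ k"] by auto
qed simp

lemma mvars_sum: "mvars (\<Sum>i\<in>I. f i) \<subseteq> (\<Union>i\<in>I. mvars (f i))"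
proof (induction I rule: infinite_finite_induct)
  case (insert i I)
  then show ?case using mvars_add[of "f i" "\<Sum>i\<in>I. f i"] by auto
qed auto

lemma mvars_prod_list: "mvars (\<Prod>k\<leftarrow>ks. f k) \<subseteq> (\<Union>k\<in>set ks. mvars (f k))"
proof (induction ks)
  case (Cons k ks)
  then show ?case using mvars_mult[of "f k" "\<Prod>k\<leftarrow>ks. f k"] by auto
qed auto

lemma mvars_hp: "mvars (hp m n k) \<subseteq> X ` {1..m} \<union> Y ` {1..n}"
proof -
  have "mvars (\<Sum>i=1..m. mvar (X i) ^ k) \<subseteq> X ` {1..m}"
    using mvars_sum[of "\<lambda>i. mvar (X i) ^ k" "{1..m}"] mvars_power[of "mvar (X _)" k]
    by (fastforce simp: mvars_mvar)
  moreover have "mvars (\<Sum>j=1..n. mvar (Y j) ^ k) \<subseteq> Y ` {1..n}"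
    using mvars_sum[of "\<lambda>j. mvar (Y j) ^ k" "{1..n}"] mvars_power[of "mvar (Y _)" k]
    by (fastforce simp: mvars_mvar)
  moreover have "mvars ((- 1) ^ (k - 1)) = {}"
    using mvars_power[of "- 1" "k - 1"] by simp
  ultimately show ?thesis unfolding hp_def
    using mvars_add[of "\<Sum>i=1..m. mvar (X i) ^ k" "(- 1) ^ (k - 1) * (\<Sum>j=1..n. mvar (Y j) ^ k)"]
      mvars_mult[of "(- 1) ^ (k - 1)" "\<Sum>j=1..n. mvar (Y j) ^ k"] by blast
qed

text \<open>
The two terms with \<open>t\<close> cancel: \<open>t^k + (-1)^(k-1) (-t)^k = 0\<close>.
\<close>

lemma specialize_hp:
  assumes "m \<ge> 1" "n \<ge> 1" "k \<ge> 1"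
  shows "specialize m n (hp m n k) = hp (m - 1) (n - 1) k"
proof -
  define \<sigma> where "\<sigma> = mvar(X m := mvar T, Y n := - mvar T)"
  have X: "(\<Sum>i=1..m. \<sigma> (X i) ^ k) = (\<Sum>i=1..m - 1. mvar (X i) ^ k) + mvar T ^ k"
  proof -
    have "{1..m} = insert m {1..m - 1}" using assms by auto
    moreover have "(\<Sum>i=1..m - 1. \<sigma> (X i) ^ k) = (\<Sum>i=1..m - 1. mvar (X i) ^ k)"
      by (intro sum.cong) (auto simp: \<sigma>_def)
    ultimately show ?thesis using assms by (simp add: \<sigma>_def add.commute)
  qed
  have Y: "(\<Sum>j=1..n. \<sigma> (Y j) ^ k) = (\<Sum>j=1..n - 1. mvar (Y j) ^ k) + (- mvar T) ^ k"
  proof -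
    have "{1..n} = insert n {1..n - 1}" using assms by auto
    moreover have "(\<Sum>j=1..n - 1. \<sigma> (Y j) ^ k) = (\<Sum>j=1..n - 1. mvar (Y j) ^ k)"
      by (intro sum.cong) (auto simp: \<sigma>_def)
    ultimately show ?thesis using assms by (simp add: \<sigma>_def add.commute)
  qed
  have T: "(- 1) ^ (k - 1) * (- mvar T) ^ k = - (mvar T ^ k)"
  proof -
    obtain k' where k': "k = Suc k'" using assms by (cases k) auto
    have "(- 1) ^ k' * (- mvar T) ^ k' = mvar T ^ k'"
      by (simp add: power_mult_distrib [symmetric])
    then show ?thesis by (simp add: k' mult.left_commute)
  qed
  have "specialize m n (hp m n k) =
      (\<Sum>i=1..m. \<sigma> (X i) ^ k) + (- 1) ^ (k - 1) * (\<Sum>j=1..n. \<sigma> (Y j) ^ k)"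
    unfolding specialize_def msubst_peval \<sigma>_def[symmetric] by (rule peval_hp[OF coeff_hom_mconst])
  also have "\<dots> = hp (m - 1) (n - 1) k + mvar T ^ k + (- 1) ^ (k - 1) * (- mvar T) ^ k"
    unfolding X Y hp_def by (simp add: distrib_left)
  finally show ?thesis unfolding T by simp
qed

lemma homogeneous_mult:
  assumes "homogeneous_or_zero a f" "homogeneous_or_zero b g"
  shows "homogeneous_or_zero (a + b) (f * g)"
  unfolding homogeneous_or_zero_def
proof
  fix \<mu> assume "\<mu> \<in> Poly_Mapping.keys (f * g)"
  then obtain \<nu> \<kappa> where e: "\<mu> = \<nu> + \<kappa>" "\<nu> \<in> Poly_Mapping.keys f" "\<kappa> \<in> Poly_Mapping.keys g"
    using keys_mult[of f g] by blast
  have mdeg: "mdeg \<mu> = (\<Sum>v\<in>V. Poly_Mapping.lookup \<mu> v)" if "finite V" "Poly_Mapping.keys \<mu> \<subseteq> V" for \<mu> V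
    unfolding mdeg_def using that by (intro sum.mono_neutral_left) (auto simp: in_keys_iff)
  let ?V = "Poly_Mapping.keys \<nu> \<union> Poly_Mapping.keys \<kappa>"
  have "mdeg (\<nu> + \<kappa>) = mdeg \<nu> + mdeg \<kappa>"
    using keys_add[of \<nu> \<kappa>] by (simp add: mdeg[of ?V] lookup_add sum.distrib)
  then show "mdeg \<mu> = a + b" using assms e by (auto simp: homogeneous_or_zero_def)
qed

lemma homogeneous_add:
  "homogeneous_or_zero a f \<Longrightarrow> homogeneous_or_zero a g \<Longrightarrow> homogeneous_or_zero a (f + g)"
  using keys_add[of f g] by (auto simp: homogeneous_or_zero_def)

lemma homogeneous_0: "homogeneous_or_zero a 0"
  and homogeneous_const: "homogeneous_or_zero 0 (mconst c)"
  and homogeneous_1: "homogeneous_or_zero 0 1"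
  and homogeneous_mvar: "homogeneous_or_zero 1 (mvar v)"
  by (auto simp: homogeneous_or_zero_def mconst_def mvar_def mdeg_def)

lemma homogeneous_uminus: "homogeneous_or_zero a f \<Longrightarrow> homogeneous_or_zero a (- f)"
  by (simp add: homogeneous_or_zero_def in_keys_iff)

lemma homogeneous_sum:
  "(\<And>i. i \<in> I \<Longrightarrow> homogeneous_or_zero a (f i)) \<Longrightarrow> homogeneous_or_zero a (\<Sum>i\<in>I. f i)"
  by (induction I rule: infinite_finite_induct) (auto intro: homogeneous_0 homogeneous_add)

lemma homogeneous_power:
  assumes "homogeneous_or_zero a f"
  shows "homogeneous_or_zero (k * a) (f ^ k)"
proof (induction k)
  case (Suc k)
  then show ?case using homogeneous_mult[OF assms Suc] by simp
qed (simp add: homogeneous_1)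

lemma homogeneous_hp: "homogeneous_or_zero k (hp m n k)"
proof -
  have "homogeneous_or_zero k (mvar v ^ k)" for v
    using homogeneous_power[OF homogeneous_mvar, of k v] by simp
  moreover have "homogeneous_or_zero 0 ((- 1) ^ (k - 1))"
    using homogeneous_power[OF homogeneous_uminus[OF homogeneous_1], of "k - 1"] by simp
  ultimately have "homogeneous_or_zero (0 + k) ((- 1) ^ (k - 1) * (\<Sum>j=1..n. mvar (Y j) ^ k))"
    by (intro homogeneous_mult homogeneous_sum) auto
  then show ?thesis
    unfolding hp_def using homogeneous_power[OF homogeneous_mvar, of k]
    by (intro homogeneous_add homogeneous_sum) auto
qed

lemma homogeneous_hp_part: "homogeneous_or_zero (sum_list la) (hp_part m n la)"
  unfolding hp_part_def
  by (induction la) (auto intro: homogeneous_1 homogeneous_mult homogeneous_hp)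

lemma hp_part_in_Lambda_deg:
  assumes mn: "m \<ge> 1" "n \<ge> 1" and la: "la \<in> partitions r"
  shows "hp_part m n la \<in> Lambda_deg m n r"
proof -
  have pos: "k \<ge> 1" if "k \<in> set la" for k
    using la that by (auto simp: partitions_def Suc_le_eq)
  have vars: "mvars (hp_part m n' la) \<subseteq> X ` {1..m} \<union> Y ` {1..n'}" for m n'
    unfolding hp_part_def using mvars_prod_list[of "hp m n'" la] mvars_hp by blast
  have "symmetric_X m (hp_part m n la)"
    unfolding symmetric_X_def msubst_peval
  proof (intro allI impI)
    fix \<pi> assume \<pi>: "\<pi> permutes {1..m}"
    have "(\<Sum>i=1..m. mvar (X (\<pi> i)) ^ k) = (\<Sum>i=1..m. mvar (X i) ^ k)" for k
      using sum.permute[OF \<pi>, of "\<lambda>i. mvar (X i) ^ k"] by (simp add: o_def)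
    then show "peval mconst (\<lambda>v. mvar (perm_X \<pi> v)) (hp_part m n la) = hp_part m n la"
      by (simp add: peval_hp_part peval_hp coeff_hom_mconst) (simp add: hp_part_def hp_def)
  qed
  moreover have "symmetric_Y n (hp_part m n la)"
    unfolding symmetric_Y_def msubst_peval
  proof (intro allI impI)
    fix \<pi> assume \<pi>: "\<pi> permutes {1..n}"
    have "(\<Sum>j=1..n. mvar (Y (\<pi> j)) ^ k) = (\<Sum>j=1..n. mvar (Y j) ^ k)" for k
      using sum.permute[OF \<pi>, of "\<lambda>j. mvar (Y j) ^ k"] by (simp add: o_def)
    then show "peval mconst (\<lambda>v. mvar (perm_Y \<pi> v)) (hp_part m n la) = hp_part m n la"
      by (simp add: peval_hp_part peval_hp coeff_hom_mconst) (simp add: hp_part_def hp_def)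
  qed
  moreover have "specialize m n (hp_part m n la) = hp_part (m - 1) (n - 1) la"
    unfolding hp_part_def
    using pos specialize_hp[OF mn]
    by (simp add: specialize_def msubst_peval peval_prod_list coeff_hom_mconst cong: map_cong)
  then have "T \<notin> mvars (specialize m n (hp_part m n la))" using vars by auto
  ultimately show ?thesis
    using vars[of m n] homogeneous_hp_part[of la m n] la
    by (simp add: Lambda_deg_def Lambda_def partitions_def)
qed

lemma lookup_scale: "Poly_Mapping.lookup (mpoly_scale c f) \<mu> = c * Poly_Mapping.lookup f \<mu>"
proof -
  have "mpoly_scale c f = Poly_Mapping.map ((*) c) f"
    by (simp add: mpoly_scale_def mconst_def mult_map_scale_conv_mult)
  then show ?thesis by (simp add: Poly_Mapping.map.rep_eq when_def)
qed

lemma subspace_Lambda_deg: "mpoly.subspace (Lambda_deg m n r)"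
proof (rule mpoly.subspaceI)
  show "0 \<in> Lambda_deg m n r"
    by (simp add: Lambda_deg_def Lambda_def symmetric_X_def symmetric_Y_def specialize_def
        msubst_peval homogeneous_0)
next
  fix f g assume fg: "f \<in> Lambda_deg m n r" "g \<in> Lambda_deg m n r"
  have "specialize m n (f + g) = specialize m n f + specialize m n g"
    by (simp add: specialize_def msubst_peval peval_add coeff_hom_mconst)
  then show "f + g \<in> Lambda_deg m n r"
    using fg mvars_add[of f g] mvars_add[of "specialize m n f" "specialize m n g"]
    by (auto simp: Lambda_deg_def Lambda_def symmetric_X_def symmetric_Y_def msubst_peval
        peval_add coeff_hom_mconst intro: homogeneous_add)
next
  fix c f assume f: "f \<in> Lambda_deg m n r"
  have "specialize m n (mpoly_scale c f) = mconst c * specialize m n f"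
    by (simp add: specialize_def msubst_peval peval_mult coeff_hom_mconst mpoly_scale_def)
  then show "mpoly_scale c f \<in> Lambda_deg m n r"
    using f mvars_mult[of "mconst c" f] mvars_mult[of "mconst c" "specialize m n f"]
      homogeneous_mult[OF homogeneous_const, of r f c]
    by (auto simp: Lambda_deg_def Lambda_def symmetric_X_def symmetric_Y_def msubst_peval
        peval_mult coeff_hom_mconst mpoly_scale_def)
qed

section \<open>Coefficients of supersymmetric polynomials\<close>

lemma lookup_map_key:
  "inj \<tau> \<Longrightarrow> Poly_Mapping.lookup (Poly_Mapping.map_key \<tau> \<mu>) v = Poly_Mapping.lookup \<mu> (\<tau> v)"
  by (simp add: Poly_Mapping.map_key.rep_eq)

lemma mvar_power: "mvar v ^ k = Poly_Mapping.single (Poly_Mapping.single v k) 1"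
  by (induction k) (simp_all add: mvar_def mult_single single_add [symmetric])

lemma prod_single_1:
  "(\<Prod>v\<in>S. Poly_Mapping.single (g v) (1::complex)) = Poly_Mapping.single (\<Sum>v\<in>S. g v) 1"
  for g :: "'a \<Rightarrow> monom"
  by (induction S rule: infinite_finite_induct) (simp_all add: mult_single)

text \<open>
Renaming the variables by a bijection permutes the monomials, so symmetry of a polynomial is
invariance of its coefficients.
\<close>

lemma lookup_msubst_rename:
  assumes "bij \<tau>"
  shows "Poly_Mapping.lookup (msubst (\<lambda>v. mvar (\<tau> v)) f) \<mu> =
    Poly_Mapping.lookup f (Poly_Mapping.map_key \<tau> \<mu>)"
proof -
  have inj: "inj \<tau>" using assms by (rule bij_is_inj)
  have monomial: "mconst c * (\<Prod>v\<in>Poly_Mapping.keys \<nu>. mvar (\<tau> v) ^ Poly_Mapping.lookup \<nu> v) =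
      Poly_Mapping.single (\<Sum>v\<in>Poly_Mapping.keys \<nu>. Poly_Mapping.single (\<tau> v) (Poly_Mapping.lookup \<nu> v)) c"
    for c \<nu>
    by (simp add: mvar_power prod_single_1 mconst_def mult_single)
  have ren: "(\<Sum>v\<in>Poly_Mapping.keys \<nu>. Poly_Mapping.single (\<tau> v) (Poly_Mapping.lookup \<nu> v)) = \<mu> \<longleftrightarrow>
      \<nu> = Poly_Mapping.map_key \<tau> \<mu>" (is "?r \<nu> = \<mu> \<longleftrightarrow> _") for \<nu>
  proof -
    have r: "Poly_Mapping.lookup (?r \<nu>) (\<tau> w) = Poly_Mapping.lookup \<nu> w" for w
    proof -
      have "Poly_Mapping.lookup (?r \<nu>) (\<tau> w) =
          (\<Sum>v\<in>Poly_Mapping.keys \<nu>. if v = w then Poly_Mapping.lookup \<nu> v else 0)"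
        using inj by (auto simp: lookup_sum lookup_single when_def inj_eq intro!: sum.cong)
      then show ?thesis by (simp add: in_keys_iff)
    qed
    show ?thesis
    proof
      assume "?r \<nu> = \<mu>"
      then show "\<nu> = Poly_Mapping.map_key \<tau> \<mu>"
        using r by (intro poly_mapping_eqI) (auto simp: lookup_map_key[OF inj])
    next
      assume \<nu>: "\<nu> = Poly_Mapping.map_key \<tau> \<mu>"
      show "?r \<nu> = \<mu>"
      proof (rule poly_mapping_eqI)
        fix v
        obtain w where "v = \<tau> w" using assms by (metis bij_pointE)
        then show "Poly_Mapping.lookup (?r \<nu>) v = Poly_Mapping.lookup \<mu> v"
          using r[of w] lookup_map_key[OF inj, of \<mu> w] \<nu> by simp
      qed
    qed
  qed
  have "Poly_Mapping.lookup (msubst (\<lambda>v. mvar (\<tau> v)) f) \<mu> =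
      (\<Sum>\<nu>\<in>Poly_Mapping.keys f. if \<nu> = Poly_Mapping.map_key \<tau> \<mu> then Poly_Mapping.lookup f \<nu> else 0)"
    unfolding msubst_def monomial lookup_sum lookup_single when_def ren ..
  then show ?thesis by (simp add: in_keys_iff)
qed

lemma bij_perm_X: "\<pi> permutes S \<Longrightarrow> bij (perm_X \<pi>)"
  and bij_perm_Y: "\<pi> permutes S \<Longrightarrow> bij (perm_Y \<pi>)"
proof -
  assume \<pi>: "\<pi> permutes S"
  have X: "perm_X p (perm_X q v) = v" and Y: "perm_Y p (perm_Y q v) = v" if "p \<circ> q = id" for p q v
    using that by (cases v; simp add: pointfree_idE)+
  note inv = permutes_inv_o[OF \<pi>]
  show "bij (perm_X \<pi>)" by (rule o_bij[of "perm_X (Hilbert_Choice.inv \<pi>)"]) (auto simp: X inv fun_eq_iff)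
  show "bij (perm_Y \<pi>)" by (rule o_bij[of "perm_Y (Hilbert_Choice.inv \<pi>)"]) (auto simp: Y inv fun_eq_iff)
qed

lemma coeff_perm_X:
  "symmetric_X m f \<Longrightarrow> \<pi> permutes {1..m} \<Longrightarrow>
    Poly_Mapping.lookup f (Poly_Mapping.map_key (perm_X \<pi>) \<mu>) = Poly_Mapping.lookup f \<mu>"
  using lookup_msubst_rename[OF bij_perm_X, of \<pi> _ f \<mu>] by (simp add: symmetric_X_def)

lemma coeff_perm_Y:
  "symmetric_Y n f \<Longrightarrow> \<pi> permutes {1..n} \<Longrightarrow>
    Poly_Mapping.lookup f (Poly_Mapping.map_key (perm_Y \<pi>) \<mu>) = Poly_Mapping.lookup f \<mu>"
  using lookup_msubst_rename[OF bij_perm_Y, of \<pi> _ f \<mu>] by (simp add: symmetric_Y_def)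

lemma meval_perm_X:
  "symmetric_X m f \<Longrightarrow> \<pi> permutes {1..m} \<Longrightarrow> meval (\<lambda>v. \<rho> (perm_X \<pi> v)) f = meval \<rho> f"
  using peval_msubst[OF coeff_hom_id, of \<rho> "\<lambda>v. mvar (perm_X \<pi> v)" f]
  by (simp add: symmetric_X_def coeff_hom_id)

lemma meval_perm_Y:
  "symmetric_Y n f \<Longrightarrow> \<pi> permutes {1..n} \<Longrightarrow> meval (\<lambda>v. \<rho> (perm_Y \<pi> v)) f = meval \<rho> f"
  using peval_msubst[OF coeff_hom_id, of \<rho> "\<lambda>v. mvar (perm_Y \<pi> v)" f]
  by (simp add: symmetric_Y_def coeff_hom_id)

text \<open>
The cancellation condition in terms of values: the specialization does not involve \<open>T\<close>, so \<open>t\<close> may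
be replaced by 0.
\<close>

lemma meval_cancel:
  assumes f: "f \<in> Lambda m n"
  shows "meval (\<rho>(X m := t, Y n := - t)) f = meval (\<rho>(X m := 0, Y n := 0)) f"
proof -
  have spec: "meval (\<rho>(T := s)) (specialize m n f) = meval (\<rho>(X m := s, Y n := - s)) f" for s
  proof -
    have "meval (\<rho>(T := s)) (specialize m n f) =
        meval (\<lambda>v. meval (\<rho>(T := s)) ((mvar(X m := mvar T, Y n := - mvar T)) v)) f"
      unfolding specialize_def by (rule peval_msubst[OF coeff_hom_id])
    also have "\<dots> = meval (\<rho>(X m := s, Y n := - s)) f"
      using f by (intro peval_cong) (auto simp: Lambda_def peval_uminus coeff_hom_id)
    finally show ?thesis .
  qed
  have "meval (\<rho>(T := t)) (specialize m n f) = meval (\<rho>(T := 0)) (specialize m n f)"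
    using f by (intro peval_cong) (auto simp: Lambda_def)
  then show ?thesis by (simp add: spec)
qed

definition xy_vars :: "nat \<Rightarrow> nat \<Rightarrow> var set" where
  "xy_vars a b = X ` {1..a} \<union> Y ` {1..b}"

text \<open>
Permuting the \<open>x\<close> and the \<open>y\<close> moves the opposite values to \<open>x\<^sub>m\<close> and \<open>y\<^sub>n\<close>, where they can both be
replaced by 0. Undoing the permutation of the \<open>x\<close> and one of those of the \<open>y\<close> gives a point at
which only \<open>a - 1\<close> of the \<open>x\<close> and \<open>b - 1\<close> of the \<open>y\<close> can be nonzero.
\<close>

lemma meval_opposite_eq_0:
  assumes f: "f \<in> Lambda m n" and ab: "1 \<le> a" "a \<le> m" "1 \<le> b" "b \<le> n"
    and vanish: "\<And>\<rho>. (\<And>v. v \<notin> xy_vars (a - 1) (b - 1) \<Longrightarrow> \<rho> v = 0) \<Longrightarrow> meval \<rho> f = 0"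
    and supp: "\<And>v. v \<notin> xy_vars a b \<Longrightarrow> \<rho> v = 0"
    and j: "j \<in> {1..b}" and opp: "\<rho> (X a) = - \<rho> (Y j)"
  shows "meval \<rho> f = 0"
proof -
  have sym: "symmetric_X m f" "symmetric_Y n f" using f by (auto simp: Lambda_def)
  let ?p = "perm_Y (Transposition.transpose j b)"
  let ?q = "perm_Y (Transposition.transpose b n)"
  let ?s = "perm_X (Transposition.transpose a m)"
  have perms: "Transposition.transpose j b permutes {1..n}" "Transposition.transpose b n permutes {1..n}"
    "Transposition.transpose a m permutes {1..m}"
    using ab j by (auto intro!: permutes_swap_id)
  define \<rho>' where "\<rho>' = (\<lambda>v. \<rho> (?p (?s (?q v))))"
  define \<rho>0 where "\<rho>0 = \<rho>'(X m := 0, Y n := 0)"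
  have "meval \<rho> f = meval (\<lambda>v. \<rho> (?p v)) f"
    by (rule meval_perm_Y[OF sym(2) perms(1), symmetric])
  also have "\<dots> = meval (\<lambda>v. \<rho> (?p (?s v))) f"
    by (rule meval_perm_X[OF sym(1) perms(3), symmetric])
  also have "\<dots> = meval \<rho>' f"
    unfolding \<rho>'_def by (rule meval_perm_Y[OF sym(2) perms(2), symmetric])
  also have "\<rho>' = \<rho>'(X m := \<rho> (X a), Y n := - \<rho> (X a))"
    using opp by (auto simp: \<rho>'_def fun_eq_iff)
  also have "meval \<dots> f = meval \<rho>0 f"
    unfolding \<rho>0_def by (rule meval_cancel[OF f])
  also have "\<dots> = meval (\<lambda>v. \<rho>0 (?s v)) f"
    by (rule meval_perm_X[OF sym(1) perms(3), symmetric])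
  also have "\<dots> = meval (\<lambda>v. \<rho>0 (?s (?q v))) f"
    by (rule meval_perm_Y[OF sym(2) perms(2), symmetric])
  also have "\<dots> = 0"
  proof (rule vanish)
    fix v assume v: "v \<notin> xy_vars (a - 1) (b - 1)"
    show "\<rho>0 (?s (?q v)) = 0"
    proof (cases v)
      case (X i)
      show ?thesis
      proof (cases "i = a")
        case True
        then show ?thesis by (simp add: X \<rho>0_def)
      next
        case False
        then have "X i \<notin> xy_vars a b" using v X by (auto simp: xy_vars_def)
        moreover have "Transposition.transpose a m i \<noteq> m"
          using False by (metis transpose_apply_second transpose_involutory)
        ultimately show ?thesis using supp[of "X i"] by (simp add: X \<rho>0_def \<rho>'_def)
      qed
    next
      case (Y i)
      show ?thesis
      proof (cases "i = b")
        case True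
        then show ?thesis by (simp add: Y \<rho>0_def)
      next
        case False
        then have "i \<notin> {1..b}" using v Y by (auto simp: xy_vars_def)
        then have "Transposition.transpose j b i = i"
          using j False by (intro transpose_apply_other) auto
        moreover have "Y i \<notin> xy_vars a b" using \<open>i \<notin> {1..b}\<close> by (auto simp: xy_vars_def)
        moreover have "Transposition.transpose b n i \<noteq> n"
          using False by (metis transpose_apply_second transpose_involutory)
        ultimately show ?thesis using supp[of "Y i"] by (simp add: Y \<rho>0_def \<rho>'_def)
      qed
    next
      case T
      then show ?thesis using supp[of T] by (auto simp: \<rho>0_def \<rho>'_def xy_vars_def)
    qed
  qed
  finally show ?thesis .
qed

lemma meval_supported:
  assumes "\<And>v. v \<notin> xy_vars a b \<Longrightarrow> \<rho> v = 0"
  shows "meval \<rho> f = (\<Sum>\<mu> | \<mu> \<in> Poly_Mapping.keys f \<and> Poly_Mapping.keys \<mu> \<subseteq> xy_vars a b.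
    Poly_Mapping.lookup f \<mu> * ((\<Prod>i\<in>{1..a}. \<rho> (X i) ^ Poly_Mapping.lookup \<mu> (X i)) *
      (\<Prod>j\<in>{1..b}. \<rho> (Y j) ^ Poly_Mapping.lookup \<mu> (Y j))))"
  unfolding peval_def
proof (rule sum.mono_neutral_cong_right)
  show "\<forall>\<mu>\<in>Poly_Mapping.keys f - {\<mu> \<in> Poly_Mapping.keys f. Poly_Mapping.keys \<mu> \<subseteq> xy_vars a b}.
      Poly_Mapping.lookup f \<mu> * (\<Prod>v\<in>Poly_Mapping.keys \<mu>. \<rho> v ^ Poly_Mapping.lookup \<mu> v) = 0"
  proof
    fix \<mu> assume "\<mu> \<in> Poly_Mapping.keys f - {\<mu> \<in> Poly_Mapping.keys f. Poly_Mapping.keys \<mu> \<subseteq> xy_vars a b}"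
    then obtain v where v: "v \<in> Poly_Mapping.keys \<mu>" "v \<notin> xy_vars a b" by auto
    then have "\<rho> v ^ Poly_Mapping.lookup \<mu> v = 0" using assms by (simp add: in_keys_iff)
    then show "Poly_Mapping.lookup f \<mu> * (\<Prod>v\<in>Poly_Mapping.keys \<mu>. \<rho> v ^ Poly_Mapping.lookup \<mu> v) = 0"
      using v(1) by (auto intro!: prod_zero)
  qed
  fix \<mu> assume "\<mu> \<in> {\<mu> \<in> Poly_Mapping.keys f. Poly_Mapping.keys \<mu> \<subseteq> xy_vars a b}"
  then have "(\<Prod>v\<in>Poly_Mapping.keys \<mu>. \<rho> v ^ Poly_Mapping.lookup \<mu> v) =
      (\<Prod>v\<in>xy_vars a b. \<rho> v ^ Poly_Mapping.lookup \<mu> v)"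
    by (intro prod_keys_superset) (auto simp: xy_vars_def)
  also have "\<dots> = (\<Prod>i\<in>{1..a}. \<rho> (X i) ^ Poly_Mapping.lookup \<mu> (X i)) *
      (\<Prod>j\<in>{1..b}. \<rho> (Y j) ^ Poly_Mapping.lookup \<mu> (Y j))"
    unfolding xy_vars_def by (subst prod.union_disjoint) (auto simp: prod.reindex inj_on_def)
  finally show "Poly_Mapping.lookup f \<mu> * (\<Prod>v\<in>Poly_Mapping.keys \<mu>. \<rho> v ^ Poly_Mapping.lookup \<mu> v) =
      Poly_Mapping.lookup f \<mu> * ((\<Prod>i\<in>{1..a}. \<rho> (X i) ^ Poly_Mapping.lookup \<mu> (X i)) *
      (\<Prod>j\<in>{1..b}. \<rho> (Y j) ^ Poly_Mapping.lookup \<mu> (Y j)))" by simp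
qed auto

text \<open>
The part of \<open>f\<close> in \<open>x\<^sub>1, \<dots>, x\<^sub>a, y\<^sub>1, \<dots>, y\<^sub>b\<close> vanishes when \<open>x\<^sub>a = - y\<^sub>j\<close> for some \<open>j \<le> b\<close>. Were
it nonzero, choose a monomial \<open>\<mu>0\<close> in it with as many \<open>x\<close>-exponents as possible that are at least
\<open>b\<close>. By hypothesis some \<open>x\<close>-exponent is smaller; by symmetry let it be that of \<open>x\<^sub>a\<close> (\<open>\<mu>1\<close>).
Collect the monomials with the same exponents of \<open>x\<^sub>1, \<dots>, x\<^sub>a\<^sub>-\<^sub>1\<close> (\<open>L\<close>): by maximality they all
have degree less than \<open>b\<close> in \<open>x\<^sub>a\<close>, but for distinct values of the \<open>y\<^sub>j\<close> their sum has the \<open>b\<close>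
roots \<open>- y\<^sub>j\<close>. So it is zero, including the coefficient of \<open>\<mu>1\<close>.
\<close>

lemma coefficients_vanish_step:
  assumes f: "f \<in> Lambda m n" and ab: "1 \<le> a" "a \<le> m" "1 \<le> b" "b \<le> n"
    and smaller: "\<And>\<mu>. Poly_Mapping.keys \<mu> \<subseteq> xy_vars (a - 1) (b - 1) \<Longrightarrow> Poly_Mapping.lookup f \<mu> = 0"
    and large: "\<And>\<mu>. Poly_Mapping.keys \<mu> \<subseteq> xy_vars a b \<Longrightarrow>
      (\<And>i. i \<in> {1..a} \<Longrightarrow> b \<le> Poly_Mapping.lookup \<mu> (X i)) \<Longrightarrow> Poly_Mapping.lookup f \<mu> = 0"
    and \<nu>: "Poly_Mapping.keys \<nu> \<subseteq> xy_vars a b"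
  shows "Poly_Mapping.lookup f \<nu> = 0"
proof (rule ccontr)
  assume "Poly_Mapping.lookup f \<nu> \<noteq> 0"
  define K where "K = {\<mu> \<in> Poly_Mapping.keys f. Poly_Mapping.keys \<mu> \<subseteq> xy_vars a b}"
  have K: "finite K" "\<nu> \<in> K" using \<nu> \<open>Poly_Mapping.lookup f \<nu> \<noteq> 0\<close> by (auto simp: K_def in_keys_iff)
  \<comment> \<open>the indices of the x-exponents that are at least b\<close>
  define B where "B = (\<lambda>\<mu>. {i \<in> {1..a}. b \<le> Poly_Mapping.lookup \<mu> (X i)})"
  obtain \<mu>0 where \<mu>0: "\<mu>0 \<in> K" "\<And>\<mu>. \<mu> \<in> K \<Longrightarrow> card (B \<mu>) \<le> card (B \<mu>0)"
  proof -
    have "Max ((\<lambda>\<mu>. card (B \<mu>)) ` K) \<in> (\<lambda>\<mu>. card (B \<mu>)) ` K" using K by (intro Max_in) auto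
    then obtain \<mu>0 where "\<mu>0 \<in> K" "card (B \<mu>0) = Max ((\<lambda>\<mu>. card (B \<mu>)) ` K)" by auto
    then show ?thesis using that K(1) by simp
  qed
  have "Poly_Mapping.lookup f \<mu>0 \<noteq> 0" using \<mu>0(1) by (simp add: K_def in_keys_iff)
  then obtain i where i: "i \<in> {1..a}" "Poly_Mapping.lookup \<mu>0 (X i) < b"
    using large[of \<mu>0] \<mu>0(1) by (force simp: K_def not_le)
  let ?t = "Transposition.transpose i a"
  have t: "?t permutes {1..a}" "?t permutes {1..m}" using i ab by (auto intro!: permutes_swap_id)
  define \<mu>1 where "\<mu>1 = Poly_Mapping.map_key (perm_X ?t) \<mu>0"
  have inj: "inj (perm_X ?t)" using bij_perm_X[OF t(1)] by (rule bij_is_inj)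
  have \<mu>1_X: "Poly_Mapping.lookup \<mu>1 (X k) = Poly_Mapping.lookup \<mu>0 (X (?t k))" for k
    by (simp add: \<mu>1_def lookup_map_key[OF inj])
  have \<mu>1_K: "\<mu>1 \<in> K"
  proof -
    have "Poly_Mapping.lookup f \<mu>1 = Poly_Mapping.lookup f \<mu>0"
      using f t(2) unfolding \<mu>1_def by (intro coeff_perm_X) (auto simp: Lambda_def)
    moreover have "Poly_Mapping.keys \<mu>1 \<subseteq> xy_vars a b"
    proof
      fix v assume "v \<in> Poly_Mapping.keys \<mu>1"
      then have "perm_X ?t v \<in> xy_vars a b"
        using \<mu>0(1) by (auto simp: \<mu>1_def keys_map_key[OF inj] K_def)
      then show "v \<in> xy_vars a b"
        using permutes_in_image[OF t(1)] by (cases v) (auto simp: xy_vars_def)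
    qed
    ultimately show ?thesis using \<mu>0(1) by (simp add: K_def in_keys_iff)
  qed
  have \<mu>1_a: "Poly_Mapping.lookup \<mu>1 (X a) < b" using i(2) by (simp add: \<mu>1_X)
  have card_B: "card (B \<mu>1) = card (B \<mu>0)"
  proof (rule bij_betw_same_card[of ?t])
    have "?t ` B \<mu>1 = B \<mu>0"
    proof (intro equalityI subsetI)
      fix k assume "k \<in> B \<mu>0"
      then have "?t k \<in> B \<mu>1" using permutes_in_image[OF t(1), of k] by (auto simp: B_def \<mu>1_X)
      then show "k \<in> ?t ` B \<mu>1" by (metis imageI transpose_involutory)
    next
      fix k assume "k \<in> ?t ` B \<mu>1"
      then show "k \<in> B \<mu>0" using permutes_in_image[OF t(1)] by (auto simp: B_def \<mu>1_X)
    qed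
    then show "bij_betw ?t (B \<mu>1) (B \<mu>0)"
      by (intro bij_betw_imageI inj_on_subset[OF permutes_inj[OF t(1)]]) auto
  qed
  define L where "L = {\<mu> \<in> K. \<forall>l\<in>{1..a - 1}. Poly_Mapping.lookup \<mu> (X l) = Poly_Mapping.lookup \<mu>1 (X l)}"
  have L_a: "Poly_Mapping.lookup \<mu> (X a) < b" if \<mu>: "\<mu> \<in> L" for \<mu>
  proof (rule ccontr)
    assume "\<not> ?thesis"
    have "insert a (B \<mu>1) \<subseteq> B \<mu>"
    proof
      fix k assume k: "k \<in> insert a (B \<mu>1)"
      show "k \<in> B \<mu>"
      proof (cases "k = a")
        case True
        then show ?thesis using \<open>\<not> Poly_Mapping.lookup \<mu> (X a) < b\<close> ab by (simp add: B_def)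
      next
        case False
        then have "k \<in> B \<mu>1" "k \<in> {1..a - 1}" using k by (auto simp: B_def)
        then show ?thesis using \<mu> by (auto simp: B_def L_def)
      qed
    qed
    moreover have "a \<notin> B \<mu>1" using \<mu>1_a by (simp add: B_def)
    moreover have "finite (B \<mu>)" for \<mu> by (simp add: B_def)
    ultimately have "Suc (card (B \<mu>1)) \<le> card (B \<mu>)" by (metis card_insert_disjoint card_mono)
    then show False using \<mu>0(2)[of \<mu>] \<mu> card_B by (simp add: L_def)
  qed
  have root: "(\<Sum>\<mu>\<in>L. Poly_Mapping.lookup f \<mu> *
      (\<Prod>j\<in>{1..b}. \<eta> j ^ Poly_Mapping.lookup \<mu> (Y j)) * (- \<eta> j0) ^ Poly_Mapping.lookup \<mu> (X a)) = 0"
    if j0: "j0 \<in> {1..b}" for \<eta> :: "nat \<Rightarrow> complex" and j0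
  proof -
    let ?c = "\<lambda>\<mu>. Poly_Mapping.lookup f \<mu> *
      (\<Prod>j\<in>{1..b}. \<eta> j ^ Poly_Mapping.lookup \<mu> (Y j)) * (- \<eta> j0) ^ Poly_Mapping.lookup \<mu> (X a)"
    have "(\<Sum>\<mu>\<in>K. ?c \<mu> * (\<Prod>l\<in>{1..a - 1}. x l ^ Poly_Mapping.lookup \<mu> (X l))) = 0" for x
    proof -
      define \<rho> where "\<rho> = (\<lambda>v. case v of X i \<Rightarrow> if i = a then - \<eta> j0 else if i \<in> {1..a} then x i else 0
        | Y j \<Rightarrow> if j \<in> {1..b} then \<eta> j else 0 | T \<Rightarrow> 0)"
      have supp: "\<rho> v = 0" if "v \<notin> xy_vars a b" for v
        using that ab by (auto simp: \<rho>_def xy_vars_def split: var.splits)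
      have "meval \<rho> f = 0"
      proof (rule meval_opposite_eq_0[OF f ab _ supp j0])
        fix \<rho>' :: "var \<Rightarrow> complex"
        assume "\<And>v. v \<notin> xy_vars (a - 1) (b - 1) \<Longrightarrow> \<rho>' v = 0"
        then show "meval \<rho>' f = 0"
          using smaller by (subst meval_supported[of "a - 1" "b - 1"]) auto
      qed (use j0 in \<open>auto simp: \<rho>_def\<close>)
      moreover have "meval \<rho> f = (\<Sum>\<mu>\<in>K. ?c \<mu> * (\<Prod>l\<in>{1..a - 1}. x l ^ Poly_Mapping.lookup \<mu> (X l)))"
      proof -
        have "(\<Prod>i\<in>{1..a}. \<rho> (X i) ^ Poly_Mapping.lookup \<mu> (X i)) =
            (- \<eta> j0) ^ Poly_Mapping.lookup \<mu> (X a) * (\<Prod>l\<in>{1..a - 1}. x l ^ Poly_Mapping.lookup \<mu> (X l))" for \<mu>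
        proof -
          have "{1..a} = insert a {1..a - 1}" using ab by auto
          moreover have "(\<Prod>l\<in>{1..a - 1}. \<rho> (X l) ^ Poly_Mapping.lookup \<mu> (X l)) =
              (\<Prod>l\<in>{1..a - 1}. x l ^ Poly_Mapping.lookup \<mu> (X l))"
            by (intro prod.cong) (auto simp: \<rho>_def)
          ultimately show ?thesis using ab by (simp add: \<rho>_def)
        qed
        moreover have "(\<Prod>j\<in>{1..b}. \<rho> (Y j) ^ Poly_Mapping.lookup \<mu> (Y j)) =
            (\<Prod>j\<in>{1..b}. \<eta> j ^ Poly_Mapping.lookup \<mu> (Y j))" for \<mu>
          by (intro prod.cong) (auto simp: \<rho>_def)
        ultimately show ?thesis
          using meval_supported[where f = f and \<rho> = \<rho>, OF supp] by (simp add: K_def mult_ac)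
      qed
      ultimately show ?thesis by simp
    qed
    from multivariate_coeff_eq_0[where e = "\<lambda>\<mu> l. Poly_Mapping.lookup \<mu> (X l)"
        and k = "\<lambda>l. Poly_Mapping.lookup \<mu>1 (X l)", OF _ K(1) this]
    show ?thesis by (simp add: L_def)
  qed
  define k where "k = Poly_Mapping.lookup \<mu>1 (X a)"
  define M where "M = {\<mu> \<in> L. Poly_Mapping.lookup \<mu> (X a) = k}"
  have fin: "finite L" "finite M" using K(1) by (auto simp: L_def M_def)
  have "(\<Sum>\<mu>\<in>M. Poly_Mapping.lookup f \<mu> * (\<Prod>j\<in>{1..b}. \<eta> j ^ Poly_Mapping.lookup \<mu> (Y j))) = 0"
    if \<eta>: "inj_on \<eta> {1..b}" for \<eta>
  proof -
    let ?c = "\<lambda>\<mu>. Poly_Mapping.lookup f \<mu> * (\<Prod>j\<in>{1..b}. \<eta> j ^ Poly_Mapping.lookup \<mu> (Y j))"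
    define p where "p = (\<Sum>\<mu>\<in>L. Polynomial.monom (?c \<mu>) (Poly_Mapping.lookup \<mu> (X a)))"
    have "p = 0"
    proof (rule ccontr)
      assume "p \<noteq> 0"
      have "(\<lambda>j. - \<eta> j) ` {1..b} \<subseteq> {t. poly p t = 0}"
      proof
        fix s assume "s \<in> (\<lambda>j. - \<eta> j) ` {1..b}"
        then obtain j where "j \<in> {1..b}" "s = - \<eta> j" by blast
        then show "s \<in> {t. poly p t = 0}"
          using root[of j \<eta>] unfolding p_def poly_sum poly_monom mem_Collect_eq by simp
      qed
      then have "card ((\<lambda>j. - \<eta> j) ` {1..b}) \<le> card {t. poly p t = 0}"
        by (rule card_mono[OF poly_roots_finite[OF \<open>p \<noteq> 0\<close>]])
      also have "card ((\<lambda>j. - \<eta> j) ` {1..b}) = b"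
      proof -
        have "inj_on (\<lambda>j. - \<eta> j) {1..b}"
          using \<eta> unfolding inj_on_def by (metis minus_minus)
        from card_image[OF this] show ?thesis by simp
      qed
      finally have "b \<le> degree p" using card_poly_roots_bound[OF \<open>p \<noteq> 0\<close>] by linarith
      moreover have "degree p \<le> b - 1"
        unfolding p_def
      proof (rule degree_sum_le)
        fix \<mu> assume "\<mu> \<in> L"
        then have "Poly_Mapping.lookup \<mu> (X a) \<le> b - 1" using L_a[of \<mu>] by simp
        then show "degree (Polynomial.monom (?c \<mu>) (Poly_Mapping.lookup \<mu> (X a))) \<le> b - 1"
          by (rule order.trans[OF degree_monom_le])
      qed (rule fin)
      ultimately show False using ab by simp
    qed
    then have "0 = coeff p k" by simp
    also have "\<dots> = (\<Sum>\<mu>\<in>L. if Poly_Mapping.lookup \<mu> (X a) = k then ?c \<mu> else 0)"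
      by (simp add: p_def coeff_sum del: One_nat_def)
    also have "\<dots> = (\<Sum>\<mu>\<in>M. ?c \<mu>)" unfolding M_def by (rule sum.inter_filter[OF fin(1), symmetric])
    finally show ?thesis by simp
  qed
  from multivariate_coeff_eq_0[where e = "\<lambda>\<mu> j. Poly_Mapping.lookup \<mu> (Y j)"
      and k = "\<lambda>j. Poly_Mapping.lookup \<mu>1 (Y j)", OF _ fin(2) this]
  have "(\<Sum>\<mu> | \<mu> \<in> M \<and> (\<forall>j\<in>{1..b}. Poly_Mapping.lookup \<mu> (Y j) = Poly_Mapping.lookup \<mu>1 (Y j)).
      Poly_Mapping.lookup f \<mu>) = 0" by simp
  moreover have "{\<mu>. \<mu> \<in> M \<and> (\<forall>j\<in>{1..b}. Poly_Mapping.lookup \<mu> (Y j) = Poly_Mapping.lookup \<mu>1 (Y j))} = {\<mu>1}"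
  proof (intro equalityI subsetI)
    fix \<mu> assume \<mu>: "\<mu> \<in> {\<mu>. \<mu> \<in> M \<and> (\<forall>j\<in>{1..b}. Poly_Mapping.lookup \<mu> (Y j) = Poly_Mapping.lookup \<mu>1 (Y j))}"
    have "Poly_Mapping.lookup \<mu> v = Poly_Mapping.lookup \<mu>1 v" for v
    proof (cases "v \<in> xy_vars a b")
      case True
      then consider "v = X a" | l where "v = X l" "l \<in> {1..a - 1}" | j where "v = Y j" "j \<in> {1..b}"
        by (fastforce simp: xy_vars_def)
      then show ?thesis using \<mu> by cases (auto simp: M_def L_def k_def)
    next
      case False
      then have "v \<notin> Poly_Mapping.keys \<mu>" "v \<notin> Poly_Mapping.keys \<mu>1"
        using \<mu> \<mu>1_K by (auto simp: M_def L_def K_def)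
      then show ?thesis by (simp add: in_keys_iff)
    qed
    then show "\<mu> \<in> {\<mu>1}" by (simp add: poly_mapping_eqI)
  qed (use \<mu>1_K in \<open>auto simp: M_def L_def k_def\<close>)
  ultimately have "Poly_Mapping.lookup f \<mu>1 = 0" by simp
  then show False using \<mu>1_K by (simp add: K_def in_keys_iff)
qed

text \<open>
Induction along the restrictions that set one \<open>x\<close> and one \<open>y\<close> to 0. When no \<open>x\<close> or no \<open>y\<close> is left,
the bound on the \<open>x\<close>-exponents is void.
\<close>

lemma Lambda_eq_0:
  assumes f: "f \<in> Lambda m n"
    and large: "\<And>a b \<mu>. a + n = b + m \<Longrightarrow> a \<le> m \<Longrightarrow> b \<le> n \<Longrightarrow> Poly_Mapping.keys \<mu> \<subseteq> xy_vars a b \<Longrightarrow>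
      (\<And>i. i \<in> {1..a} \<Longrightarrow> b \<le> Poly_Mapping.lookup \<mu> (X i)) \<Longrightarrow> Poly_Mapping.lookup f \<mu> = 0"
  shows "f = 0"
proof -
  have vanish: "Poly_Mapping.lookup f \<mu> = 0"
    if "a + n = b + m" "a \<le> m" "b \<le> n" "Poly_Mapping.keys \<mu> \<subseteq> xy_vars a b" for a b \<mu>
    using that
  proof (induction a arbitrary: b \<mu>)
    case 0
    then show ?case using large[of 0 b \<mu>] by simp
  next
    case (Suc a)
    show ?case
    proof (cases b)
      case 0
      then show ?thesis using large[of "Suc a" b \<mu>] Suc.prems by simp
    next
      case (Suc b')
      show ?thesis
      proof (rule coefficients_vanish_step[OF f, of "Suc a" b])
        fix \<mu> :: monom assume "Poly_Mapping.keys \<mu> \<subseteq> xy_vars (Suc a - 1) (b - 1)"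
        then show "Poly_Mapping.lookup f \<mu> = 0"
          using Suc.prems Suc by (intro Suc.IH[of "b - 1"]) auto
      next
        fix \<mu> :: monom
        assume "Poly_Mapping.keys \<mu> \<subseteq> xy_vars (Suc a) b"
          and "\<And>i. i \<in> {1..Suc a} \<Longrightarrow> b \<le> Poly_Mapping.lookup \<mu> (X i)"
        then show "Poly_Mapping.lookup f \<mu> = 0"
          using large[of "Suc a" b \<mu>] Suc.prems by blast
      qed (use Suc.prems Suc in auto)
    qed
  qed
  show ?thesis
  proof (rule poly_mapping_eqI)
    fix \<mu> :: monom
    show "Poly_Mapping.lookup f \<mu> = Poly_Mapping.lookup 0 \<mu>"
    proof (cases "\<mu> \<in> Poly_Mapping.keys f")
      case True
      then have "Poly_Mapping.keys \<mu> \<subseteq> xy_vars m n"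
        using f unfolding Lambda_def mvars_def xy_vars_def by blast
      then show ?thesis using vanish[of m n \<mu>] by simp
    qed (simp add: in_keys_iff)
  qed
qed

section \<open>Monomials and partitions in the hook\<close>

lemma sorting_permutation:
  fixes g :: "nat \<Rightarrow> nat"
  obtains \<pi> where "\<pi> permutes {1..a}" "\<And>i j. 1 \<le> i \<Longrightarrow> i \<le> j \<Longrightarrow> j \<le> a \<Longrightarrow> g (\<pi> j) \<le> g (\<pi> i)"
proof -
  define xs where "xs = map (\<lambda>i. g (Suc i)) [0..<a]"
  have len: "length xs = a" by (simp add: xs_def)
  have "mset (rev (sort xs)) = mset xs" by simp
  then obtain p where p: "p permutes {..<a}" "permute_list p xs = rev (sort xs)"
    using mset_eq_permutation[of "rev (sort xs)" xs] len by metis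
  define \<pi> where "\<pi> = (\<lambda>i. if i \<in> {1..a} then Suc (p (i - 1)) else i)"
  have "bij_betw (\<lambda>i. i - 1) {1..a} {..<a}"
    by (rule bij_betw_byWitness[where f' = Suc]) auto
  moreover have "bij_betw p {..<a} {..<a}" using p(1) by (rule permutes_imp_bij)
  moreover have "bij_betw Suc {..<a} {1..a}"
    by (rule bij_betw_byWitness[where f' = "\<lambda>i. i - 1"]) auto
  ultimately have "bij_betw (Suc \<circ> (p \<circ> (\<lambda>i. i - 1))) {1..a} {1..a}"
    by (blast intro: bij_betw_trans)
  then have "bij_betw \<pi> {1..a} {1..a}"
    by (rule bij_betw_cong[THEN iffD1, rotated]) (simp add: \<pi>_def)
  then have "\<pi> permutes {1..a}"
    by (rule bij_imp_permutes) (auto simp: \<pi>_def)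
  moreover have "g (\<pi> j) \<le> g (\<pi> i)" if "1 \<le> i" "i \<le> j" "j \<le> a" for i j
  proof -
    have g: "g (\<pi> k) = rev (sort xs) ! (k - 1)" if "1 \<le> k" "k \<le> a" for k
    proof -
      have "p (k - 1) < a" using permutes_in_image[OF p(1), of "k - 1"] that by auto
      then have "g (\<pi> k) = xs ! p (k - 1)" using that by (simp add: \<pi>_def xs_def)
      also have "\<dots> = permute_list p xs ! (k - 1)"
        using p(1) that len by (subst permute_list_nth) auto
      finally show ?thesis by (simp add: p(2))
    qed
    have "sorted_wrt (\<ge>) (rev (sort xs))" by (simp add: sorted_wrt_rev)
    then show ?thesis
      using g[of i] g[of j] that len sorted_wrt_nth_less[of "(\<ge>)" "rev (sort xs)" "i - 1" "j - 1"]
      by (cases "i = j") auto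
  qed
  ultimately show ?thesis using that by blast
qed

text \<open>
For \<open>p \<le> q\<close> the diagram of a partition in the hook contains a largest rectangle with \<open>a \<le> p\<close> rows
and \<open>a + (q - p)\<close> columns; \<open>corner\<close> is its number \<open>a\<close> of rows (for \<open>p = q\<close> large, the side of the
Durfee square). As the parts decrease, it can be found by counting.
\<close>

definition corner :: "nat \<Rightarrow> nat \<Rightarrow> nat list \<Rightarrow> nat" where
  "corner p q la = card {i \<in> {1..p}. i + (q - p) \<le> part la i}"

text \<open>
The length of the \<open>j\<close>-th column of the diagram below row \<open>a\<close>.
\<close>

definition leg :: "nat list \<Rightarrow> nat \<Rightarrow> nat \<Rightarrow> nat" where
  "leg la a j = card {i \<in> {a<..length la}. j \<le> part la i}"

text \<open>
Put the \<open>\<alpha>\<^sub>i\<close> as rows on top of the transpose of \<open>\<beta>\<close>, whose rows \<open>col\<close> have length at most \<open>b\<close>.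
This is a partition in the hook, because row \<open>p + 1\<close> lies below row \<open>a\<close> and \<open>b \<le> q\<close>.
\<close>

lemma hook_partition_exists:
  assumes pq: "p \<le> q" and a: "a \<le> p" and b: "b = a + (q - p)"
    and \<alpha>: "\<And>i j. 1 \<le> i \<Longrightarrow> i \<le> j \<Longrightarrow> j \<le> a \<Longrightarrow> \<alpha> j \<le> \<alpha> i"
    and \<alpha>b: "\<And>i. i \<in> {1..a} \<Longrightarrow> b \<le> \<alpha> i"
    and \<beta>: "\<And>i j. 1 \<le> i \<Longrightarrow> i \<le> j \<Longrightarrow> j \<le> b \<Longrightarrow> \<beta> j \<le> \<beta> i"
    and r: "(\<Sum>i\<in>{1..a}. \<alpha> i) + (\<Sum>j\<in>{1..b}. \<beta> j) = r"
  obtains la where "la \<in> hook p q r" "corner p q la = a"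
    "\<And>i. i \<in> {1..a} \<Longrightarrow> part la i = \<alpha> i" "\<And>j. j \<in> {1..b} \<Longrightarrow> leg la a j = \<beta> j"
proof -
  \<comment> \<open>the number of rows of the transpose; without columns the value of \<beta> at 1 is arbitrary\<close>
  define N where "N = (if b = 0 then 0 else \<beta> 1)"
  define col where "col = (\<lambda>k. card {j \<in> {1..b}. k \<le> \<beta> j})"
  define la where "la = map \<alpha> [1..<Suc a] @ map col [1..<Suc N]"
  have len: "length la = a + N" by (simp add: la_def)
  have \<beta>N: "\<beta> j \<le> N" if "j \<in> {1..b}" for j
    using \<beta>[of 1 j] that by (auto simp: N_def)
  have col_0: "col k = 0" if "k > N" for k
  proof -
    have "{j \<in> {1..b}. k \<le> \<beta> j} = {}" using \<beta>N that by fastforce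
    then show ?thesis by (simp only: col_def card.empty)
  qed
  have col_b: "col k \<le> b" for k
  proof -
    have "card {j \<in> {1..b}. k \<le> \<beta> j} \<le> card {1..b}" by (intro card_mono) auto
    then show ?thesis by (simp add: col_def)
  qed
  have col_mono: "col k \<le> col l" if "l \<le> k" for k l
    unfolding col_def using that by (intro card_mono) auto
  have col_pos: "col k > 0" if "1 \<le> k" "k \<le> N" for k
  proof -
    have "b \<noteq> 0" "k \<le> \<beta> 1" using that by (auto simp: N_def split: if_splits)
    then have "1 \<in> {j \<in> {1..b}. k \<le> \<beta> j}" by auto
    then show ?thesis unfolding col_def by (subst card_gt_0_iff) auto
  qed
  have col_iff: "j \<le> col k \<longleftrightarrow> k \<le> \<beta> j" if "j \<in> {1..b}" for j k
  proof
    assume "k \<le> \<beta> j"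
    then have "{1..j} \<subseteq> {j \<in> {1..b}. k \<le> \<beta> j}"
      using \<beta>[of _ j] that by (auto intro: order.trans)
    from card_mono[OF _ this] show "j \<le> col k" by (simp add: col_def)
  next
    assume le: "j \<le> col k"
    show "k \<le> \<beta> j"
    proof (rule ccontr)
      assume "\<not> k \<le> \<beta> j"
      have "{i \<in> {1..b}. k \<le> \<beta> i} \<subseteq> {1..<j}"
      proof
        fix i assume i: "i \<in> {i \<in> {1..b}. k \<le> \<beta> i}"
        have "\<not> j \<le> i"
        proof
          assume "j \<le> i"
          then have "\<beta> i \<le> \<beta> j" using \<beta>[of j i] that i by simp
          then show False using i \<open>\<not> k \<le> \<beta> j\<close> by simp
        qed
        then show "i \<in> {1..<j}" using i by simp
      qed
      from card_mono[OF _ this] have "col k \<le> j - 1" by (simp add: col_def)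
      then show False using le that by auto
    qed
  qed
  have part_a: "part la i = \<alpha> i" if "i \<in> {1..a}" for i
    using that by (auto simp: part_def la_def nth_append simp del: upt_Suc)
  have part_col: "part la i = col (i - a)" if "a < i" for i
  proof (cases "i \<le> a + N")
    case True
    then show ?thesis using that by (auto simp: part_def la_def nth_append Suc_diff_Suc simp del: upt_Suc)
  next
    case False
    then show ?thesis using col_0[of "i - a"] that len by (auto simp: part_def)
  qed
  have part_le_b: "part la i \<le> b" if "a < i" for i
    using part_col[OF that] col_b by simp
  have "sorted_wrt (\<ge>) la"
    unfolding la_def sorted_wrt_append
  proof (intro conjI ballI)
    show "sorted_wrt (\<ge>) (map \<alpha> [1..<Suc a])"
      by (auto simp: sorted_wrt_iff_nth_less simp del: upt_Suc intro!: \<alpha>)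
    show "sorted_wrt (\<ge>) (map col [1..<Suc N])"
      by (auto simp: sorted_wrt_iff_nth_less simp del: upt_Suc intro!: col_mono)
    fix u w assume "u \<in> set (map \<alpha> [1..<Suc a])" "w \<in> set (map col [1..<Suc N])"
    then obtain i k where "u = \<alpha> i" "i \<in> {1..a}" "w = col k" by (auto simp del: upt_Suc)
    then show "w \<le> u" using \<alpha>b[of i] col_b[of k] by simp
  qed
  moreover have "\<forall>k\<in>set la. k > 0"
  proof
    fix k assume "k \<in> set la"
    then consider i where "k = \<alpha> i" "i \<in> {1..a}" | i where "k = col i" "i \<in> {1..N}"
      by (auto simp: la_def simp del: upt_Suc)
    then show "k > 0"
    proof cases
      case 1
      then show ?thesis using \<alpha>b[of i] b by auto
    next
      case 2
      then show ?thesis using col_pos[of i] by simp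
    qed
  qed
  moreover have "sum_list la = r"
  proof -
    have "(\<Sum>k\<in>{1..N}. col k) = (\<Sum>k\<in>{1..N}. \<Sum>j\<in>{1..b}. if k \<le> \<beta> j then 1 else 0)"
      unfolding col_def by (intro sum.cong refl) (simp add: sum.If_cases Int_def)
    also have "\<dots> = (\<Sum>j\<in>{1..b}. \<Sum>k\<in>{1..N}. if k \<le> \<beta> j then 1 else 0)" by (rule sum.swap)
    also have "\<dots> = (\<Sum>j\<in>{1..b}. \<beta> j)"
    proof (intro sum.cong refl)
      fix j assume "j \<in> {1..b}"
      then have "{1..N} \<inter> {k. k \<le> \<beta> j} = {1..\<beta> j}" using \<beta>N[of j] by auto
      then show "(\<Sum>k\<in>{1..N}. if k \<le> \<beta> j then 1 else 0) = \<beta> j" by (simp add: sum.If_cases)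
    qed
    finally have "(\<Sum>k\<in>{1..N}. col k) = (\<Sum>j\<in>{1..b}. \<beta> j)" .
    moreover have "sum_list la = (\<Sum>i\<in>{1..a}. \<alpha> i) + (\<Sum>k\<in>{1..N}. col k)"
      unfolding la_def sum_list_append
      by (simp only: interv_sum_list_conv_sum_set_nat set_upt atLeastLessThanSuc_atLeastAtMost)
    ultimately show ?thesis using r by simp
  qed
  moreover have "part la (p + 1) \<le> q" using part_le_b[of "p + 1"] a b pq by simp
  ultimately have "la \<in> hook p q r" by (simp add: hook_def partitions_def)
  moreover have "corner p q la = a"
  proof -
    have "{i \<in> {1..p}. i + (q - p) \<le> part la i} = {1..a}"
    proof (intro equalityI subsetI)
      fix i assume "i \<in> {1..a}"
      then show "i \<in> {i \<in> {1..p}. i + (q - p) \<le> part la i}"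
        using part_a[of i] \<alpha>b[of i] a b by auto
    next
      fix i assume i: "i \<in> {i \<in> {1..p}. i + (q - p) \<le> part la i}"
      then have "\<not> a < i" using part_le_b[of i] b by auto
      then show "i \<in> {1..a}" using i by auto
    qed
    then show ?thesis by (simp add: corner_def)
  qed
  moreover have "leg la a j = \<beta> j" if j: "j \<in> {1..b}" for j
  proof -
    have "{i \<in> {a<..length la}. j \<le> part la i} = {a<..a + \<beta> j}"
      using \<beta>N[OF j] col_iff[OF j] part_col by (auto simp: len)
    then show ?thesis by (simp add: leg_def)
  qed
  ultimately show ?thesis using that part_a by blast
qed

definition xy_monom :: "nat \<Rightarrow> nat \<Rightarrow> (nat \<Rightarrow> nat) \<Rightarrow> (nat \<Rightarrow> nat) \<Rightarrow> monom" where
  "xy_monom a b \<xi> \<psi> = (\<Sum>i\<in>{1..a}. Poly_Mapping.single (X i) (\<xi> i)) +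
     (\<Sum>j\<in>{1..b}. Poly_Mapping.single (Y j) (\<psi> j))"

lemma lookup_xy_monom:
  "Poly_Mapping.lookup (xy_monom a b \<xi> \<psi>) (X i) = (if i \<in> {1..a} then \<xi> i else 0)"
  "Poly_Mapping.lookup (xy_monom a b \<xi> \<psi>) (Y j) = (if j \<in> {1..b} then \<psi> j else 0)"
  "Poly_Mapping.lookup (xy_monom a b \<xi> \<psi>) T = 0"
  by (simp_all add: xy_monom_def lookup_add lookup_sum lookup_single when_def)

lemma xy_monom_cong:
  assumes "\<And>i. i \<in> {1..a} \<Longrightarrow> \<xi> i = \<xi>' i" "\<And>j. j \<in> {1..b} \<Longrightarrow> \<psi> j = \<psi>' j"
  shows "xy_monom a b \<xi> \<psi> = xy_monom a b \<xi>' \<psi>'"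
  unfolding xy_monom_def using assms by (intro arg_cong2[where f = plus] sum.cong) auto

text \<open>
The monomial read off a partition in the dual hook. For \<open>m \<le> n\<close> the rows of the upper part are the
\<open>x\<close>-exponents, and the columns of the lower part the \<open>y\<close>-exponents. For \<open>n < m\<close> the roles are
exchanged, and the rectangle is moved from the \<open>y\<close>-exponents to the \<open>x\<close>-exponents, because it is
the \<open>x\<close>-exponents that have a lower bound.
\<close>

definition hook_monom :: "nat \<Rightarrow> nat \<Rightarrow> nat list \<Rightarrow> monom" where
  "hook_monom m n la =
    (if m \<le> n then
      let a = corner m n la in xy_monom a (a + (n - m)) (part la) (leg la a)
    else
      let b = corner n m la; a = b + (m - n) in
        xy_monom a b (\<lambda>i. b + leg la b i) (\<lambda>j. part la j - a))"

lemma xy_monom_in_hook_monoms: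
  assumes ab: "a + n = b + m" "a \<le> m" "b \<le> n"
    and \<xi>: "\<And>i j. 1 \<le> i \<Longrightarrow> i \<le> j \<Longrightarrow> j \<le> a \<Longrightarrow> \<xi> j \<le> \<xi> i"
    and \<xi>b: "\<And>i. i \<in> {1..a} \<Longrightarrow> b \<le> \<xi> i"
    and \<psi>: "\<And>i j. 1 \<le> i \<Longrightarrow> i \<le> j \<Longrightarrow> j \<le> b \<Longrightarrow> \<psi> j \<le> \<psi> i"
    and r: "(\<Sum>i\<in>{1..a}. \<xi> i) + (\<Sum>j\<in>{1..b}. \<psi> j) = r"
  shows "xy_monom a b \<xi> \<psi> \<in> hook_monom m n ` hook_dual m n r"
proof (cases "m \<le> n")
  case True
  then have b: "b = a + (n - m)" using ab by simp
  obtain la where la: "la \<in> hook m n r" "corner m n la = a"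
    "\<And>i. i \<in> {1..a} \<Longrightarrow> part la i = \<xi> i" "\<And>j. j \<in> {1..b} \<Longrightarrow> leg la a j = \<psi> j"
    using hook_partition_exists[OF True ab(2) b \<xi> \<xi>b \<psi> r] by blast
  have "hook_monom m n la = xy_monom a b (part la) (leg la a)"
    using True la(2) b by (simp add: hook_monom_def Let_def)
  also have "\<dots> = xy_monom a b \<xi> \<psi>" using la by (intro xy_monom_cong) auto
  finally show ?thesis using la(1) True by (force simp: hook_dual_def)
next
  case False
  then have a: "a = b + (m - n)" using ab by simp
  have "(\<Sum>i\<in>{1..a}. \<xi> i) = (\<Sum>i\<in>{1..a}. (\<xi> i - b) + b)"
    using \<xi>b by (intro sum.cong) auto
  also have "\<dots> = (\<Sum>i\<in>{1..a}. \<xi> i - b) + a * b" by (simp add: sum.distrib)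
  finally have r': "(\<Sum>j\<in>{1..b}. \<psi> j + a) + (\<Sum>i\<in>{1..a}. \<xi> i - b) = r"
    using r by (simp add: sum.distrib mult.commute)
  obtain la where la: "la \<in> hook n m r" "corner n m la = b"
    "\<And>j. j \<in> {1..b} \<Longrightarrow> part la j = \<psi> j + a" "\<And>i. i \<in> {1..a} \<Longrightarrow> leg la b i = \<xi> i - b"
  proof (rule hook_partition_exists[of n m b a "\<lambda>j. \<psi> j + a" "\<lambda>i. \<xi> i - b" r])
    show "\<psi> j + a \<le> \<psi> i + a" if "1 \<le> i" "i \<le> j" "j \<le> b" for i j
      using \<psi>[OF that] by simp
    show "\<xi> j - b \<le> \<xi> i - b" if "1 \<le> i" "i \<le> j" "j \<le> a" for i j
      using \<xi>[OF that] by simp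
  qed (use False ab(3) a r' in auto)
  have "hook_monom m n la = xy_monom a b (\<lambda>i. b + leg la b i) (\<lambda>j. part la j - a)"
    using False la(2) a by (simp add: hook_monom_def Let_def)
  also have "\<dots> = xy_monom a b \<xi> \<psi>" using la \<xi>b by (intro xy_monom_cong) auto
  finally show ?thesis using la(1) False by (force simp: hook_dual_def)
qed

text \<open>
By symmetry a coefficient may be moved to weakly decreasing exponents, and the monomials with such
exponents and large \<open>x\<close>-part come from partitions in the dual hook.
\<close>

lemma Lambda_deg_eq_0:
  assumes f: "f \<in> Lambda_deg m n r"
    and zero: "\<And>\<mu>. \<mu> \<in> hook_monom m n ` hook_dual m n r \<Longrightarrow> Poly_Mapping.lookup f \<mu> = 0"
  shows "f = 0"
proof (rule Lambda_eq_0)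
  show "f \<in> Lambda m n" using f by (simp add: Lambda_deg_def)
  then have sym: "symmetric_X m f" "symmetric_Y n f" by (auto simp: Lambda_def)
  fix a b and \<mu> :: monom
  assume ab: "a + n = b + m" "a \<le> m" "b \<le> n" and keys: "Poly_Mapping.keys \<mu> \<subseteq> xy_vars a b"
    and large: "\<And>i. i \<in> {1..a} \<Longrightarrow> b \<le> Poly_Mapping.lookup \<mu> (X i)"
  show "Poly_Mapping.lookup f \<mu> = 0"
  proof (rule ccontr)
    assume nz: "Poly_Mapping.lookup f \<mu> \<noteq> 0"
    obtain \<pi> where \<pi>: "\<pi> permutes {1..a}"
      "\<And>i j. 1 \<le> i \<Longrightarrow> i \<le> j \<Longrightarrow> j \<le> a \<Longrightarrow> Poly_Mapping.lookup \<mu> (X (\<pi> j)) \<le> Poly_Mapping.lookup \<mu> (X (\<pi> i))"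
      using sorting_permutation[of a "\<lambda>i. Poly_Mapping.lookup \<mu> (X i)"] by blast
    obtain \<sigma> where \<sigma>: "\<sigma> permutes {1..b}"
      "\<And>i j. 1 \<le> i \<Longrightarrow> i \<le> j \<Longrightarrow> j \<le> b \<Longrightarrow> Poly_Mapping.lookup \<mu> (Y (\<sigma> j)) \<le> Poly_Mapping.lookup \<mu> (Y (\<sigma> i))"
      using sorting_permutation[of b "\<lambda>i. Poly_Mapping.lookup \<mu> (Y i)"] by blast
    have perms: "\<pi> permutes {1..m}" "\<sigma> permutes {1..n}"
      using \<pi>(1) \<sigma>(1) ab by (auto elim!: permutes_subset)
    define \<nu> where "\<nu> = Poly_Mapping.map_key (perm_Y \<sigma>) (Poly_Mapping.map_key (perm_X \<pi>) \<mu>)"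
    have f\<nu>: "Poly_Mapping.lookup f \<nu> = Poly_Mapping.lookup f \<mu>"
      unfolding \<nu>_def by (simp add: coeff_perm_Y[OF sym(2) perms(2)] coeff_perm_X[OF sym(1) perms(1)])
    have \<nu>: "Poly_Mapping.lookup \<nu> v = Poly_Mapping.lookup \<mu> (perm_X \<pi> (perm_Y \<sigma> v))" for v
      using bij_perm_X[OF \<pi>(1)] bij_perm_Y[OF \<sigma>(1)]
      by (simp add: \<nu>_def lookup_map_key bij_is_inj)
    have outside: "Poly_Mapping.lookup \<mu> v = 0" if "v \<notin> xy_vars a b" for v
      using keys that by (auto simp: in_keys_iff)
    let ?\<xi> = "\<lambda>i. Poly_Mapping.lookup \<nu> (X i)" and ?\<psi> = "\<lambda>j. Poly_Mapping.lookup \<nu> (Y j)"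
    have "\<nu> = xy_monom a b ?\<xi> ?\<psi>"
    proof (rule poly_mapping_eqI)
      fix v
      show "Poly_Mapping.lookup \<nu> v = Poly_Mapping.lookup (xy_monom a b ?\<xi> ?\<psi>) v"
      proof (cases v)
        case (X i)
        have "X i \<notin> xy_vars a b" if "i \<notin> {1..a}" using that by (auto simp: xy_vars_def)
        then show ?thesis
          using permutes_not_in[OF \<pi>(1), of i] outside[of "X i"] X
          by (cases "i \<in> {1..a}") (auto simp: lookup_xy_monom \<nu>)
      next
        case (Y j)
        have "Y j \<notin> xy_vars a b" if "j \<notin> {1..b}" using that by (auto simp: xy_vars_def)
        then show ?thesis
          using permutes_not_in[OF \<sigma>(1), of j] outside[of "Y j"] Y
          by (cases "j \<in> {1..b}") (auto simp: lookup_xy_monom \<nu>)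
      next
        case T
        then show ?thesis using outside[of T] by (auto simp: lookup_xy_monom \<nu> xy_vars_def)
      qed
    qed
    moreover have "xy_monom a b ?\<xi> ?\<psi> \<in> hook_monom m n ` hook_dual m n r"
    proof (rule xy_monom_in_hook_monoms[OF ab])
      show "(\<Sum>i\<in>{1..a}. ?\<xi> i) + (\<Sum>j\<in>{1..b}. ?\<psi> j) = r"
      proof -
        have "(\<Sum>i\<in>{1..a}. ?\<xi> i) = (\<Sum>i\<in>{1..a}. Poly_Mapping.lookup \<mu> (X i))"
          using sum.permute[OF \<pi>(1), of "\<lambda>i. Poly_Mapping.lookup \<mu> (X i)"] by (simp add: \<nu> o_def)
        moreover have "(\<Sum>j\<in>{1..b}. ?\<psi> j) = (\<Sum>j\<in>{1..b}. Poly_Mapping.lookup \<mu> (Y j))"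
          using sum.permute[OF \<sigma>(1), of "\<lambda>j. Poly_Mapping.lookup \<mu> (Y j)"] by (simp add: \<nu> o_def)
        moreover have "mdeg \<mu> = (\<Sum>v\<in>xy_vars a b. Poly_Mapping.lookup \<mu> v)"
          unfolding mdeg_def using keys by (intro sum.mono_neutral_left) (auto simp: xy_vars_def in_keys_iff)
        moreover have "(\<Sum>v\<in>xy_vars a b. Poly_Mapping.lookup \<mu> v) =
            (\<Sum>i\<in>{1..a}. Poly_Mapping.lookup \<mu> (X i)) + (\<Sum>j\<in>{1..b}. Poly_Mapping.lookup \<mu> (Y j))"
          unfolding xy_vars_def by (subst sum.union_disjoint) (auto simp: sum.reindex inj_on_def)
        moreover have "mdeg \<mu> = r"
          using f nz by (auto simp: Lambda_deg_def homogeneous_or_zero_def in_keys_iff)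
        ultimately show ?thesis by simp
      qed
      show "b \<le> ?\<xi> i" if "i \<in> {1..a}" for i
        using large[of "\<pi> i"] permutes_in_image[OF \<pi>(1), of i] that by (simp add: \<nu>)
    qed (use \<pi>(2) \<sigma>(2) in \<open>auto simp: \<nu>\<close>)
    ultimately have "Poly_Mapping.lookup f \<nu> = 0" using zero by metis
    then show False using f\<nu> nz by simp
  qed
qed

section \<open>The basis\<close>

text \<open>
Truncation to the monomials in \<open>M\<close> is injective on \<open>V\<close> and so maps \<open>B\<close> to an independent family in
a space spanned by \<open>card M\<close> monomials.
\<close>

lemma card_independent_le:
  assumes V: "mpoly.subspace V" and M: "finite M"
    and det: "\<And>f. f \<in> V \<Longrightarrow> (\<And>\<mu>. \<mu> \<in> M \<Longrightarrow> Poly_Mapping.lookup f \<mu> = 0) \<Longrightarrow> f = 0"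
    and B: "finite B" "mpoly.independent B" "B \<subseteq> V"
  shows "card B \<le> card M"
proof -
  define pr where "pr = (\<lambda>f :: mpoly. \<Sum>\<mu>\<in>M. Poly_Mapping.single \<mu> (Poly_Mapping.lookup f \<mu>))"
  have pr: "Poly_Mapping.lookup (pr f) \<mu> = Poly_Mapping.lookup f \<mu>" if "\<mu> \<in> M" for f \<mu>
    using that M by (simp add: pr_def lookup_sum lookup_single when_def)
  have "inj_on pr B \<and> mpoly.independent (pr ` B)"
  proof (rule mpoly.independent_familyI[OF B(1)])
    fix c f assume c: "(\<Sum>f\<in>B. mpoly_scale (c f) (pr f)) = 0" and "f \<in> B"
    have "(\<Sum>f\<in>B. mpoly_scale (c f) f) = 0"
    proof (rule det)
      show "(\<Sum>f\<in>B. mpoly_scale (c f) f) \<in> V"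
        using B(3) by (intro mpoly.subspace_sum[OF V] mpoly.subspace_scale[OF V]) auto
      fix \<mu> assume "\<mu> \<in> M"
      then show "Poly_Mapping.lookup (\<Sum>f\<in>B. mpoly_scale (c f) f) \<mu> = 0"
        using arg_cong[OF c, of "\<lambda>f. Poly_Mapping.lookup f \<mu>"] by (simp add: lookup_sum lookup_scale pr)
    qed
    then show "c f = 0"
      using mpoly.independent_familyD[of B "\<lambda>f. f" c f] B \<open>f \<in> B\<close> by simp
  qed
  moreover have "pr ` B \<subseteq> mpoly.span ((\<lambda>\<mu>. Poly_Mapping.single \<mu> 1) ` M)"
  proof
    fix g assume "g \<in> pr ` B"
    then obtain f where g: "g = pr f" by blast
    show "g \<in> mpoly.span ((\<lambda>\<mu>. Poly_Mapping.single \<mu> 1) ` M)"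
      unfolding g pr_def
    proof (rule mpoly.span_sum)
      fix \<mu> assume "\<mu> \<in> M"
      then have "mpoly_scale c (Poly_Mapping.single \<mu> 1) \<in> mpoly.span ((\<lambda>\<mu>. Poly_Mapping.single \<mu> 1) ` M)" for c
        by (intro mpoly.span_scale mpoly.span_base imageI)
      moreover have "mpoly_scale c (Poly_Mapping.single \<mu> 1) = Poly_Mapping.single \<mu> c" for c
        by (simp add: mpoly_scale_def mconst_def mult_single)
      ultimately show "Poly_Mapping.single \<mu> (Poly_Mapping.lookup f \<mu>) \<in>
          mpoly.span ((\<lambda>\<mu>. Poly_Mapping.single \<mu> 1) ` M)" by metis
    qed
  qed
  moreover from calculation have "card (pr ` B) \<le> card ((\<lambda>\<mu>. Poly_Mapping.single \<mu> (1::complex)) ` M)"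
    using mpoly.independent_span_bound[OF finite_imageI[OF M]] by blast
  ultimately have "card B \<le> card ((\<lambda>\<mu>. Poly_Mapping.single \<mu> (1::complex)) ` M)"
    by (metis card_image)
  also have "\<dots> \<le> card M" by (rule card_image_le[OF M])
  finally show ?thesis .
qed

lemma hp_parts_independent:
  assumes "m \<ge> 1" "n \<ge> 1"
  shows "inj_on (hp_part m n) (hook_dual m n r) \<and> mpoly.independent (hp_part m n ` hook_dual m n r)"
proof (rule mpoly.independent_familyI)
  show fin: "finite (hook_dual m n r)" by (simp add: hook_dual_def finite_hook)
  fix c la
  assume c: "(\<Sum>la\<in>hook_dual m n r. mpoly_scale (c la) (hp_part m n la)) = 0"
    and la: "la \<in> hook_dual m n r"
  show "c la = 0"
  proof (rule super_psum_products_independent_dual[OF assms _ la])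
    fix x z :: "nat \<Rightarrow> complex"
    define \<rho> where "\<rho> = (\<lambda>v. case v of X i \<Rightarrow> x i | Y j \<Rightarrow> - z j | T \<Rightarrow> 0)"
    have hp: "meval \<rho> (hp m n k) = super_psum m n x z k" if "k \<ge> 1" for k
    proof -
      obtain k' where k: "k = Suc k'" using \<open>k \<ge> 1\<close> by (cases k) auto
      have "(- 1) ^ (k - 1) * (- z j) ^ k = - (z j ^ k)" for j
      proof -
        have "(- 1) ^ k' * (- z j) ^ k' = z j ^ k'" by (simp add: power_mult_distrib [symmetric])
        then show ?thesis by (simp add: k mult.left_commute)
      qed
      then show ?thesis
        by (simp add: peval_hp[OF coeff_hom_id] \<rho>_def super_psum_def sum_distrib_left sum_negf del: One_nat_def)
    qed
    have "meval \<rho> (hp_part m n la) = (\<Prod>k\<leftarrow>la. super_psum m n x z k)" if "la \<in> hook_dual m n r" for la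
    proof -
      have "\<forall>k\<in>set la. k \<ge> 1" using that by (auto simp: hook_dual_def hook_def partitions_def Suc_le_eq)
      then show ?thesis by (simp add: peval_hp_part[OF coeff_hom_id] hp cong: map_cong)
    qed
    moreover have "(\<Sum>la\<in>hook_dual m n r. c la * meval \<rho> (hp_part m n la)) = 0"
      using arg_cong[OF c, of "meval \<rho>"]
      by (simp add: peval_hom_simps coeff_hom_id mpoly_scale_def)
    ultimately show "(\<Sum>la\<in>hook_dual m n r. c la * (\<Prod>k\<leftarrow>la. super_psum m n x z k)) = 0" by simp
  qed
qed

theorem theorem3p9:
  fixes m n r :: nat
  assumes "m \<ge> 1" and "n \<ge> 1"
  shows "inj_on (hp_part m n) (hook_dual m n r) \<and>
    mpoly.independent (hp_part m n ` hook_dual m n r) \<and>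
    mpoly.span (hp_part m n ` hook_dual m n r) = Lambda_deg m n r"
proof -
  let ?H = "hook_dual m n r" and ?V = "Lambda_deg m n r"
  let ?B = "hp_part m n ` ?H" and ?M = "hook_monom m n ` ?H"
  have fin: "finite ?H" by (simp add: hook_dual_def finite_hook)
  have inj: "inj_on (hp_part m n) ?H" and ind: "mpoly.independent ?B"
    using hp_parts_independent[OF assms] by auto
  have B_V: "?B \<subseteq> ?V"
    using hp_part_in_Lambda_deg[OF assms] by (auto simp: hook_dual_def hook_def)
  have "mpoly.span ?B = ?V"
  proof (intro equalityI subsetI)
    fix f assume "f \<in> mpoly.span ?B"
    then show "f \<in> ?V" using mpoly.span_minimal[OF B_V subspace_Lambda_deg] by blast
  next
    fix f assume f: "f \<in> ?V"
    show "f \<in> mpoly.span ?B"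
    proof (rule ccontr)
      assume nf: "f \<notin> mpoly.span ?B"
      then have "f \<notin> ?B" using mpoly.span_base by blast
      have "card (insert f ?B) \<le> card ?M"
      proof (rule card_independent_le[OF subspace_Lambda_deg])
        show "mpoly.independent (insert f ?B)" using mpoly.independent_insertI[OF nf ind] .
        show "insert f ?B \<subseteq> ?V" using f B_V by simp
      qed (use fin Lambda_deg_eq_0 in auto)
      also have "\<dots> \<le> card ?H" by (rule card_image_le[OF fin])
      also have "\<dots> = card ?B" using card_image[OF inj] by simp
      finally show False using \<open>f \<notin> ?B\<close> fin by simp
    qed
  qed
  with inj ind show ?thesis by blast
qed

end
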